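(* For any pair of integers $n\geq 4$ and $2\leq k\leq n-2$, there is a closed positive current $\mathscr{T}\in\mathscr{D}'_{k,k}((\mathbb{C}^* )^n)$ for which there is no family of mollifiers $\mu_t$, $t\in(0,1)$, such that (i) $\mathrm{Supp}(\mu_t\star\mathscr{T})$ converges to $\mathrm{Supp}(\mathscr{T})$ in the Hausdorff sense as $t\to0$, and (ii) the sets $\mathrm{Supp}(\mu_t\star\mathscr{T})$ have smooth boundaries.
   Context: **Currents.** On a complex manifold $X$, $\mathscr{D}'_{p,p}(X)$ is the space of currents of bidimension $(p,p)$, i.e. the topological dual of the space of smooth compactly supported $(p,p)$-forms. A current is closed if its exterior derivative (defined by duality) vanishes. A smooth $(p,p)$-form $\varphi$ is positive if $\varphi(x)|_S$ is a nonnegative volume form for every complex $p$-plane $S\subseteq T_xX$ and every $x\in X$; a current $\mathscr{T}\in\mathscr{D}'_{p,p}(X)$ is positive if $\langle\mathscr{T},\varphi\rangle\geq0$ for every positive compactly supported $(p,p)$-form $\varphi$. **Mollifiers.** Consider $G=(\mathbb{C}^* )^n$ as a Lie group under coordinatewise multiplication, with a fixed Haar measure. A family of mollifiers $\mu_t$, $t\in(0,1)$, is a family of nonnegative smooth compactly supported functions on $G$ of total integral $1$ whose supports shrink to the identity as $t\to0$. The convolution is $\mu_t\star\mathscr{T}=\int_G\mu_t(g)\,(m_g)_*\mathscr{T}\,dg$, where $m_g$ is multiplication by $g$; it is a smooth positive form (closed if $\mathscr{T}$ is), and converges weakly to $\mathscr{T}$ as $t\to 0$. **Hausdorff convergence.**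 It is understood with respect to compact subsets: closed sets $S_t$ converge to a closed set $S$ as $t\to0$ if for every compact $K$ and $\epsilon>0$, for all sufficiently small $t$, $S_t\cap K$ lies in the $\epsilon$-neighbourhood of $S$ and $S\cap K$ lies in the $\epsilon$-neighbourhood of $S_t$. **Smooth boundary.** A closed set has smooth boundary if it is a closed domain whose topological boundary is a smooth real hypersurface. Condition (ii) is required for all $t$. *)

theory Defs
  imports "HOL-Analysis.Analysis" "HOL-Combinatorics.Permutations"
begin

section \<open>Smooth functions\<close>

text \<open>
  \<open>iter_deriv [v\<^sub>1, \<dots>, v\<^sub>r] f = \<partial>\<^sub>v\<^sub>1 \<dots> \<partial>\<^sub>v\<^sub>r f\<close> (real derivatives). It is only meaningful
  when the derivatives exist, which \<open>smooth_on\<close> requires at every order.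
\<close>

primrec iter_deriv ::
    "'a::real_normed_vector list \<Rightarrow> ('a \<Rightarrow> 'b::real_normed_vector) \<Rightarrow> 'a \<Rightarrow> 'b" where
  "iter_deriv [] f = f"
| "iter_deriv (v # vs) f = (\<lambda>x. frechet_derivative (iter_deriv vs f) (at x) v)"

text \<open>\<open>C\<^sup>\<infinity>\<close> on an open set \<open>S\<close>.\<close>

definition smooth_on :: "'a::real_normed_vector set \<Rightarrow> ('a \<Rightarrow> 'b::real_normed_vector) \<Rightarrow> bool" where
  "smooth_on S f \<longleftrightarrow> (\<forall>vs. \<forall>x\<in>S. iter_deriv vs f differentiable (at x))"


section \<open>The complex torus\<close>

text \<open>
  The group law is the componentwise product \<open>(*)\<close> of vectors, with unit \<open>1\<close>.
\<close>

definition torus :: "(complex^'n) set" where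
  "torus = {z. \<forall>i. z $ i \<noteq> 0}"

text \<open>The measure \<open>\<Prod>\<^sub>i dx\<^sub>i dy\<^sub>i / \<bar>z\<^sub>i\<bar>\<^sup>2\<close>, invariant under multiplication.\<close>

definition haar :: "(complex^'n) measure" where
  "haar = density lborel
     (\<lambda>z. ennreal (indicator torus z / (\<Prod>i\<in>UNIV. (cmod (z $ i))\<^sup>2)))"


section \<open>Differential forms\<close>

text \<open>
  A form of degree \<open>m\<close> takes a point \<open>x\<close> and a sequence \<open>v\<close> of tangent vectors, of which only
  \<open>v 0, \<dots>, v (m - 1)\<close> matter. Forms are complex valued. A form with compact support in the torus
  is identified with its extension by zero to the whole vector space.
\<close>

type_synonym 'n form = "complex^'n \<Rightarrow> (nat \<Rightarrow> complex^'n) \<Rightarrow> complex"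

definition alternating_form :: "nat \<Rightarrow> ((nat \<Rightarrow> complex^'n) \<Rightarrow> complex) \<Rightarrow> bool" where
  "alternating_form m \<alpha> \<longleftrightarrow>
     (\<forall>v w. (\<forall>j<m. v j = w j) \<longrightarrow> \<alpha> v = \<alpha> w) \<and>
     (\<forall>i<m. \<forall>v. linear (\<lambda>a. \<alpha> (v(i := a)))) \<and>
     (\<forall>i<m. \<forall>j<m. \<forall>v. i \<noteq> j \<and> v i = v j \<longrightarrow> \<alpha> v = 0)"

definition wedge_covectors ::
    "nat \<Rightarrow> (nat \<Rightarrow> complex^'n \<Rightarrow> complex) \<Rightarrow> (nat \<Rightarrow> complex^'n) \<Rightarrow> complex" where
  "wedge_covectors m \<xi> v =
     (\<Sum>\<sigma> | \<sigma> permutes {..<m}. of_int (sign \<sigma>) * (\<Prod>j<m. \<xi> j (v (\<sigma> j))))"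

text \<open>
  The wedge of the \<open>dz\<close> with indices \<open>I 0, \<dots>, I (p - 1)\<close> and then of the conjugates of the \<open>dz\<close> with
  indices \<open>J 0, \<dots>, J (q - 1)\<close>. Forms of bidegree \<open>(p, q)\<close> are the linear combinations of these;
  all index tuples are allowed, since repetitions give zero.
\<close>

definition dz_wedge ::
    "nat \<Rightarrow> nat \<Rightarrow> (nat \<Rightarrow> 'n) \<Rightarrow> (nat \<Rightarrow> 'n) \<Rightarrow> (nat \<Rightarrow> complex^'n) \<Rightarrow> complex" where
  "dz_wedge p q I J =
     wedge_covectors (p + q) (\<lambda>j a. if j < p then a $ I j else cnj (a $ J (j - p)))"

definition of_bidegree :: "nat \<Rightarrow> nat \<Rightarrow> ((nat \<Rightarrow> complex^'n) \<Rightarrow> complex) \<Rightarrow> bool" where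
  "of_bidegree p q \<alpha> \<longleftrightarrow>
     (\<exists>c. \<forall>v. \<alpha> v = (\<Sum>I\<in>{..<p} \<rightarrow>\<^sub>E UNIV. \<Sum>J\<in>{..<q} \<rightarrow>\<^sub>E UNIV. c I J * dz_wedge p q I J v))"

definition form_support :: "'n::finite form \<Rightarrow> (complex^'n) set" where
  "form_support \<phi> = closure {x. \<exists>v. \<phi> x v \<noteq> 0}"

definition smooth_compact_form :: "'n::finite form \<Rightarrow> bool" where
  "smooth_compact_form \<phi> \<longleftrightarrow>
     (\<forall>v. smooth_on UNIV (\<lambda>x. \<phi> x v)) \<and> compact (form_support \<phi>) \<and> form_support \<phi> \<subseteq> torus"

definition test_form :: "nat \<Rightarrow> 'n::finite form \<Rightarrow> bool" where
  "test_form m \<phi> \<longleftrightarrow> smooth_compact_form \<phi> \<and> (\<forall>x. alternating_form m (\<phi> x))"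

definition test_form_pq :: "nat \<Rightarrow> nat \<Rightarrow> 'n::finite form \<Rightarrow> bool" where
  "test_form_pq p q \<phi> \<longleftrightarrow> smooth_compact_form \<phi> \<and> (\<forall>x. of_bidegree p q (\<phi> x))"

text \<open>
  The invariant formula for the exterior derivative of a form of degree \<open>m\<close>, on constant vector
  fields (whose brackets vanish).
\<close>

definition ext_deriv :: "nat \<Rightarrow> 'n::finite form \<Rightarrow> 'n form" where
  "ext_deriv m \<eta> = (\<lambda>x v. \<Sum>i\<le>m. (- 1) ^ i *
     frechet_derivative (\<lambda>y. \<eta> y (\<lambda>j. if j < i then v j else v (Suc j))) (at x) (v i))"

definition pullback_mult :: "complex^'n \<Rightarrow> 'n form \<Rightarrow> 'n form" where
  "pullback_mult g \<phi> = (\<lambda>x v. \<phi> (g * x) (\<lambda>j. g * v j))"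

text \<open>
  For a complex basis \<open>u\<close> of a complex \<open>p\<close>-plane \<open>S\<close>, the real basis
  \<open>u 0, \<i> u 0, \<dots>, u (p - 1), \<i> u (p - 1)\<close> is positively oriented for the complex orientation of \<open>S\<close>.
\<close>

definition positive_form :: "nat \<Rightarrow> 'n::finite form \<Rightarrow> bool" where
  "positive_form p \<phi> \<longleftrightarrow>
     (\<forall>x\<in>torus. \<forall>S u. vec.subspace S \<and> vec.dim S = p \<and> vec.span (u ` {..<p}) = S \<longrightarrow>
        \<phi> x (\<lambda>j. if even j then u (j div 2) else \<i> *s u (j div 2)) \<in> \<real>\<^sub>\<ge>\<^sub>0)"


section \<open>Currents\<close>

text \<open>
  Currents of bidimension \<open>(p, p)\<close> are linear functionals on the test forms of bidegree \<open>(p, p)\<close>;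
  their values on other arguments are irrelevant. Continuity for the inductive limit topology is
  continuity on the Frechet space of test forms supported in \<open>K\<close>, for each compact \<open>K\<close>, that is,
  a bound by one of the \<open>C\<^sup>r\<close>-norms of the coefficients.
\<close>

definition current :: "nat \<Rightarrow> ('n::finite form \<Rightarrow> complex) \<Rightarrow> bool" where
  "current p T \<longleftrightarrow>
     (\<forall>\<phi> \<psi>. test_form_pq p p \<phi> \<and> test_form_pq p p \<psi> \<longrightarrow> T (\<lambda>x v. \<phi> x v + \<psi> x v) = T \<phi> + T \<psi>) \<and>
     (\<forall>c \<phi>. test_form_pq p p \<phi> \<longrightarrow> T (\<lambda>x v. c * \<phi> x v) = c * T \<phi>) \<and>
     (\<forall>K. compact K \<and> K \<subseteq> torus \<longrightarrow>
        (\<exists>r C. \<forall>\<phi> B. test_form_pq p p \<phi> \<and> form_support \<phi> \<subseteq> K \<and> 0 \<le> B \<and>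
            (\<forall>x vs w. length vs \<le> r \<and> set vs \<subseteq> Basis \<and> range w \<subseteq> Basis \<longrightarrow>
               cmod (iter_deriv vs (\<lambda>y. \<phi> y w) x) \<le> B)
          \<longrightarrow> cmod (T \<phi>) \<le> C * B))"

text \<open>
  \<open>\<langle>dT, \<eta>\<rangle> = \<plusminus>\<langle>T, d\<eta>\<rangle>\<close> for \<open>\<eta>\<close> of degree \<open>2p - 1\<close>, where \<open>T\<close> pairs to zero with the components of
  \<open>d\<eta>\<close> of bidegree other than \<open>(p, p)\<close>. Below, \<open>d\<eta> = \<Sum>\<^sub>r \<psi>\<^sub>r\<close> is the decomposition of \<open>d\<eta>\<close> into
  components of bidegree \<open>(r, 2p - r)\<close>.
\<close>

definition closed_current :: "nat \<Rightarrow> ('n::finite form \<Rightarrow> complex) \<Rightarrow> bool" where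
  "closed_current p T \<longleftrightarrow>
     (\<forall>m \<eta> \<psi>. Suc m = 2 * p \<and> test_form m \<eta> \<and>
        (\<forall>r\<le>2 * p. test_form_pq r (2 * p - r) (\<psi> r)) \<and>
        ext_deriv m \<eta> = (\<lambda>x v. \<Sum>r\<le>2 * p. \<psi> r x v)
      \<longrightarrow> T (\<psi> p) = 0)"

definition positive_current :: "nat \<Rightarrow> ('n::finite form \<Rightarrow> complex) \<Rightarrow> bool" where
  "positive_current p T \<longleftrightarrow>
     (\<forall>\<phi>. test_form_pq p p \<phi> \<and> positive_form p \<phi> \<longrightarrow> T \<phi> \<in> \<real>\<^sub>\<ge>\<^sub>0)"

definition current_support :: "nat \<Rightarrow> ('n::finite form \<Rightarrow> complex) \<Rightarrow> (complex^'n) set" where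
  "current_support p T = torus - \<Union>{U. open U \<and> U \<subseteq> torus \<and>
     (\<forall>\<phi>. test_form_pq p p \<phi> \<and> form_support \<phi> \<subseteq> U \<longrightarrow> T \<phi> = 0)}"


section \<open>Mollifiers and convolution\<close>

definition mollifier_family :: "(real \<Rightarrow> complex^'n \<Rightarrow> real) \<Rightarrow> bool" where
  "mollifier_family \<mu> \<longleftrightarrow>
     (\<forall>t\<in>{0<..<1}.
        (\<forall>g. 0 \<le> \<mu> t g) \<and> smooth_on UNIV (\<mu> t) \<and>
        compact (closure {g. \<mu> t g \<noteq> 0}) \<and> closure {g. \<mu> t g \<noteq> 0} \<subseteq> torus \<and>
        (LINT g|haar. \<mu> t g) = 1) \<and>
     (\<forall>U. open U \<and> 1 \<in> U \<longrightarrow> (\<forall>\<^sub>F t in at_right 0. closure {g. \<mu> t g \<noteq> 0} \<subseteq> U))"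

text \<open>\<open>\<langle>(m\<^sub>g)\<^sub>* T, \<phi>\<rangle> = \<langle>T, m\<^sub>g\<^sup>* \<phi>\<rangle>\<close> is averaged against \<open>\<mu>\<close>.\<close>

definition convolution ::
    "(complex^'n \<Rightarrow> real) \<Rightarrow> ('n form \<Rightarrow> complex) \<Rightarrow> 'n form \<Rightarrow> complex" where
  "convolution \<mu> T \<phi> = (LINT g|haar. complex_of_real (\<mu> g) * T (pullback_mult g \<phi>))"


section \<open>Convergence of sets and smooth boundaries\<close>

definition hausdorff_converges ::
    "(real \<Rightarrow> (complex^'n) set) \<Rightarrow> (complex^'n) set \<Rightarrow> bool" where
  "hausdorff_converges A S \<longleftrightarrow>
     (\<forall>K \<epsilon>. compact K \<and> K \<subseteq> torus \<and> 0 < \<epsilon> \<longrightarrow>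
        (\<forall>\<^sub>F t in at_right 0.
           A t \<inter> K \<subseteq> (\<Union>s\<in>S. ball s \<epsilon>) \<and> S \<inter> K \<subseteq> (\<Union>s\<in>A t. ball s \<epsilon>)))"

definition smooth_hypersurface :: "(complex^'n) set \<Rightarrow> bool" where
  "smooth_hypersurface M \<longleftrightarrow>
     (\<forall>x\<in>M. \<exists>U (\<rho> :: complex^'n \<Rightarrow> real). open U \<and> x \<in> U \<and> U \<subseteq> torus \<and> smooth_on U \<rho> \<and>
        M \<inter> U = {y \<in> U. \<rho> y = 0} \<and>
        (\<forall>y\<in>U. frechet_derivative \<rho> (at y) \<noteq> (\<lambda>_. 0)))"

text \<open>
  A closed domain is a set that is the closure of its interior. Closure, interior and boundary are
  taken in the torus.
\<close>

definition has_smooth_boundary :: "(complex^'n) set \<Rightarrow> bool" where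
  "has_smooth_boundary S \<longleftrightarrow>
     S \<subseteq> torus \<and>
     top_of_set torus closure_of (top_of_set torus interior_of S) = S \<and>
     smooth_hypersurface (top_of_set torus frontier_of S)"

end

theory Submission
  imports Defs "Jordan_Normal_Form.Determinant"
begin

text \<open>
  Let \<open>F\<close> be the set of \<open>z\<close> with \<open>\<bar>z\<^sub>a\<bar> \<le> 1\<close> or \<open>\<bar>z\<^sub>b\<bar> \<le> 1\<close>. Its indicator function times the wedge of
  the forms \<open>\<i> dz\<^sub>i \<and> d\<close>(conjugate of \<open>z\<^sub>i\<close>) over a set of \<open>n - k \<ge> 2\<close> indices \<open>i\<close> that includes \<open>a\<close> and \<open>b\<close> is
  a positive current. It is closed because \<open>F\<close> is invariant under translations in the remaining
  coordinates. The support of its convolution with \<open>\<mu>\<close> is the product of \<open>F\<close> with the support of \<open>\<mu>\<close>,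
  that is, the set where \<open>\<bar>z\<^sub>a\<bar> \<le> R\<^sub>a\<close> or \<open>\<bar>z\<^sub>b\<bar> \<le> R\<^sub>b\<close>, with \<open>R\<^sub>i\<close> the largest value of \<open>\<bar>g\<^sub>i\<bar>\<close> on the support
  of \<open>\<mu>\<close>. Whatever \<open>\<mu>\<close> is, this set has a reentrant corner at \<open>\<bar>z\<^sub>a\<bar> = R\<^sub>a\<close>, \<open>\<bar>z\<^sub>b\<bar> = R\<^sub>b\<close>.
\<close>

section \<open>Wedges of covectors on a complex coordinate plane\<close>

no_notation Matrix.vec_index (infixl "$" 100)
hide_const (open) Matrix.vec Matrix.mat Determinant.det

text \<open>By the Leibniz formula. Two facts on determinants become available: equal rows give
  zero, and determinants are multiplicative.\<close>

lemma wedge_covectors_eq_det: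
  "wedge_covectors m \<xi> v = Determinant.det (Matrix.mat m m (\<lambda>(i, j). \<xi> i (v j)))"
proof -
  have "signof \<sigma> * (\<Prod>i = 0..<m. Matrix.mat m m (\<lambda>(i, j). \<xi> i (v j)) $$ (i, \<sigma> i)) =
      of_int (sign \<sigma>) * (\<Prod>j<m. \<xi> j (v (\<sigma> j)))" if "\<sigma> permutes {..<m}" for \<sigma>
  proof -
    have "(\<Prod>i = 0..<m. Matrix.mat m m (\<lambda>(i, j). \<xi> i (v j)) $$ (i, \<sigma> i)) = (\<Prod>j<m. \<xi> j (v (\<sigma> j)))"
      unfolding atLeast0LessThan
    proof (rule prod.cong)
      fix i assume "i \<in> {..<m}"
      then have "\<sigma> i < m" using permutes_in_image[OF that] by blast
      then show "Matrix.mat m m (\<lambda>(i, j). \<xi> i (v j)) $$ (i, \<sigma> i) = \<xi> i (v (\<sigma> i))"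
        using \<open>i \<in> {..<m}\<close> by simp
    qed simp
    then show ?thesis by simp
  qed
  then show ?thesis
    by (subst Determinant.det_def'[of _ m])
       (auto simp: wedge_covectors_def atLeast0LessThan intro!: sum.cong)
qed

lemma wedge_covectors_eq_0I:
  assumes "i < m" and "\<And>j. j < m \<Longrightarrow> \<xi> i (v j) = 0"
  shows "wedge_covectors m \<xi> v = 0"
  unfolding wedge_covectors_def
proof (rule sum.neutral, rule ballI)
  fix \<sigma> assume "\<sigma> \<in> {\<sigma>. \<sigma> permutes {..<m}}"
  then have "\<sigma> i < m" using assms(1) permutes_in_image[of \<sigma> "{..<m}" i] by simp
  then have "(\<Prod>j<m. \<xi> j (v (\<sigma> j))) = 0" using assms by (intro prod_zero) auto
  then show "of_int (sign \<sigma>) * (\<Prod>j<m. \<xi> j (v (\<sigma> j))) = 0" by simp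
qed

lemma wedge_covectors_eq_0_repeated:
  assumes "i < m" "j < m" "i \<noteq> j" "\<xi> i = \<xi> j"
  shows "wedge_covectors m \<xi> v = 0"
  unfolding wedge_covectors_eq_det
  by (rule det_identical_rows[of _ m i j]) (use assms in \<open>auto intro!: eq_vecI simp: Matrix.row_def\<close>)

text \<open>Multiplication by \<open>g\<close> acts diagonally, so it rescales each covector, and
  the factors come out of the sum over permutations.\<close>

lemma dz_wedge_mult:
  "dz_wedge p q I J (\<lambda>j. g * v j) =
     (\<Prod>j<p. g $ I j) * (\<Prod>j<q. cnj (g $ J j)) * dz_wedge p q I J v"
proof -
  have *: "(\<Prod>j<p + q. if j < p then g $ I j else cnj (g $ J (j - p))) =
      (\<Prod>j<p. g $ I j) * (\<Prod>j<q. cnj (g $ J j))"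
    by (induction q) (auto simp: mult_ac)
  have **: "(\<Prod>j<p + q. if j < p then (g * v (\<sigma> j)) $ I j else cnj ((g * v (\<sigma> j)) $ J (j - p))) =
     (\<Prod>j<p. g $ I j) * (\<Prod>j<q. cnj (g $ J j)) *
     (\<Prod>j<p + q. if j < p then v (\<sigma> j) $ I j else cnj (v (\<sigma> j) $ J (j - p)))" for \<sigma>
    unfolding *[symmetric] prod.distrib[symmetric] by (intro prod.cong) auto
  show ?thesis
    unfolding dz_wedge_def wedge_covectors_def ** by (simp add: sum_distrib_left mult_ac)
qed

lemma dz_wedge_cong:
  assumes "\<And>j. j < p \<Longrightarrow> I j = I' j" "\<And>j. j < q \<Longrightarrow> J j = J' j"
  shows "dz_wedge p q I J = dz_wedge p q I' J'"
  unfolding dz_wedge_def wedge_covectors_def using assms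
  by (intro ext sum.cong arg_cong2[where f="(*)"] prod.cong) auto

text \<open>The oriented real basis that \<^const>\<open>positive_form\<close> attaches to the basis vectors with indices \<open>s 0, s 1, \<dots>\<close>\<close>

definition frame :: "(nat \<Rightarrow> 'n) \<Rightarrow> nat \<Rightarrow> complex^'n" where
  "frame s j = (if even j then axis (s (j div 2)) 1 else \<i> *s axis (s (j div 2)) 1)"

lemma frame_nth:
  "frame s j $ i = (if i = s (j div 2) then if even j then 1 else \<i> else 0)"
  by (auto simp: frame_def axis_def)

text \<open>Continuity of a current is measured on real basis vectors; this makes values on
  \<open>frame s\<close> subject to those bounds.\<close>

lemma frame_in_Basis: "frame s j \<in> Basis"
proof -
  have "frame s j = axis (s (j div 2)) (if even j then 1 else \<i>)"
    by (auto simp: Finite_Cartesian_Product.vec_eq_iff frame_nth axis_def)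
  then show ?thesis
    by (auto simp: Basis_vec_def Basis_complex_def)
qed

text \<open>Pigeonhole: otherwise \<open>I\<close> would map \<open>p\<close> indices injectively
  into a set of at most \<open>k\<close> elements.\<close>

lemma ex_outside_or_repeated:
  assumes "k < (p :: nat)"
  shows "(\<exists>j<p. I j \<notin> s ` {..<k}) \<or> (\<exists>i<p. \<exists>j<p. i \<noteq> j \<and> I i = I j)"
proof (rule ccontr)
  assume H: "\<not> ?thesis"
  then have "inj_on I {..<p}" "I ` {..<p} \<subseteq> s ` {..<k}"
    by (auto simp: inj_on_def)
  then have "p \<le> card (s ` {..<k})"
    using card_inj_on_le[of I "{..<p}" "s ` {..<k}"] by simp
  also have "\<dots> \<le> k" using card_image_le[of "{..<k}" s] by simp
  finally show False using assms by simp
qed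

text \<open>
  One of the two kinds of covectors occurs more than \<open>k\<close> times, so that it contains a repetition or
  a covector vanishing on the \<open>k\<close>-plane.
\<close>

lemma dz_wedge_frame_eq_0:
  assumes "p + q = 2 * k" "p \<noteq> k"
  shows "dz_wedge p q I J (frame s) = 0"
proof -
  let ?\<xi> = "\<lambda>j a. if j < p then a $ I j else cnj (a $ J (j - p))"
  have div: "l div 2 < k" if "l < p + q" for l using that assms by auto
  consider "k < p" | "k < q" using assms by linarith
  then show ?thesis
  proof cases
    case 1
    from ex_outside_or_repeated[OF this, of I s] show ?thesis
    proof
      assume "\<exists>j<p. I j \<notin> s ` {..<k}"
      then obtain j where "j < p" "I j \<notin> s ` {..<k}" by blast
      then show ?thesis unfolding dz_wedge_def
        by (intro wedge_covectors_eq_0I[of j]) (auto simp: frame_nth dest: div)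
    next
      assume "\<exists>i<p. \<exists>j<p. i \<noteq> j \<and> I i = I j"
      then obtain i j where "i < p" "j < p" "i \<noteq> j" "I i = I j" by blast
      then show ?thesis unfolding dz_wedge_def
        by (intro wedge_covectors_eq_0_repeated[of i _ j]) auto
    qed
  next
    case 2
    from ex_outside_or_repeated[OF this, of J s] show ?thesis
    proof
      assume "\<exists>j<q. J j \<notin> s ` {..<k}"
      then obtain j where "j < q" "J j \<notin> s ` {..<k}" by blast
      then show ?thesis unfolding dz_wedge_def
        by (intro wedge_covectors_eq_0I[of "p + j"]) (auto simp: frame_nth dest: div)
    next
      assume "\<exists>i<q. \<exists>j<q. i \<noteq> j \<and> J i = J j"
      then obtain i j where "i < q" "j < q" "i \<noteq> j" "J i = J j" by blast
      then show ?thesis unfolding dz_wedge_def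
        by (intro wedge_covectors_eq_0_repeated[of "p + i" _ "p + j"]) auto
    qed
  qed
qed

lemma sum_pairs: "(\<Sum>l<2 * k. f l) = (\<Sum>m<k. f (2 * m) + f (Suc (2 * m)))"
  for f :: "nat \<Rightarrow> 'a::comm_monoid_add"
  by (induction k) (auto simp: ac_simps)

text \<open>Lets a test form be scaled so that its constant factor is 1 on the frame.\<close>

lemma dz_wedge_frame_nonzero:
  assumes "inj_on s {..<k}"
  shows "dz_wedge k k s s (frame s) \<noteq> 0"
proof -
  txt \<open>Up to the factor \<open>\<surd>2\<close>, the matrix of pairings is unitary.\<close>
  define \<xi> where "\<xi> j a = (if j < k then a $ s j else cnj (a $ s (j - k)))" for j and a :: "complex^'a"
  define A where "A = Matrix.mat (2 * k) (2 * k) (\<lambda>(i, j). \<xi> i (frame s j))"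
  define B where "B = Matrix.mat (2 * k) (2 * k) (\<lambda>(j, i). cnj (\<xi> i (frame s j)))"
  have inj: "s i = s j \<longleftrightarrow> i = j" if "i < k" "j < k" for i j
    using assms that by (auto simp: inj_on_def)
  have *: "(\<Sum>l<2 * k. \<xi> i (frame s l) * cnj (\<xi> j (frame s l))) = (if i = j then 2 else 0)"
    if "i < 2 * k" "j < 2 * k" for i j
  proof -
    define i' where "i' = (if i < k then i else i - k)"
    define j' where "j' = (if j < k then j else j - k)"
    have [simp]: "i' < k" "j' < k" using that by (auto simp: i'_def j'_def)
    \<comment> \<open>Each pair of frame vectors sees a single coordinate. There, equal covectors
      contribute \<open>1 + 1\<close>, while a \<open>dz\<close> and its own conjugate contribute
      \<open>1 - 1\<close>.\<close>
    have "\<xi> i (frame s (2 * m)) * cnj (\<xi> j (frame s (2 * m))) +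
          \<xi> i (frame s (Suc (2 * m))) * cnj (\<xi> j (frame s (Suc (2 * m)))) =
          (if m = i' then if i = j then 2 else 0 else 0)" if "m < k" for m
      using that \<open>i < 2 * k\<close> \<open>j < 2 * k\<close>
      by (auto simp: \<xi>_def frame_nth inj i'_def j'_def)
    then have "(\<Sum>l<2 * k. \<xi> i (frame s l) * cnj (\<xi> j (frame s l))) =
        (\<Sum>m<k. if m = i' then if i = j then 2 else 0 else 0)"
      unfolding sum_pairs by (intro sum.cong) auto
    then show ?thesis by simp
  qed
  have "A * B = 2 \<cdot>\<^sub>m 1\<^sub>m (2 * k)"
    by (rule eq_matI)
       (auto simp: A_def B_def scalar_prod_def Matrix.row_def Matrix.col_def atLeast0LessThan *)
  then have "Determinant.det A * Determinant.det B = 2 ^ (2 * k)"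
    by (subst det_mult[symmetric, of _ "2 * k"]) (auto simp: A_def B_def)
  then have "Determinant.det A \<noteq> 0" by auto
  then show ?thesis
    by (simp add: dz_wedge_def wedge_covectors_eq_det A_def \<xi>_def mult_2)
qed

section \<open>Smooth bump functions\<close>

text \<open>Differentiating \<open>exp (- 1 / t)\<close> produces powers of \<open>1 / t\<close>;
  indexing by these powers makes the span of the family closed under derivatives.\<close>

definition flat_exp :: "nat \<Rightarrow> real \<Rightarrow> real" where
  "flat_exp m t = (if t \<le> 0 then 0 else exp (- 1 / t) / t ^ m)"

text \<open>On the right, substituting \<open>u = 1 / t\<close> reduces this to the decay of
  \<open>u ^ m / exp u\<close> at infinity.\<close>

lemma flat_exp_tendsto_0: "(flat_exp m \<longlongrightarrow> 0) (at 0)"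
proof -
  have "((\<lambda>t. inverse t ^ m / exp (inverse t)) \<longlongrightarrow> 0) (at_right (0 :: real))"
    by (rule filterlim_compose[OF tendsto_power_div_exp_0 filterlim_inverse_at_top_right])
  then have "(flat_exp m \<longlongrightarrow> 0) (at_right 0)"
    by (rule filterlim_cong[THEN iffD1, rotated -1])
       (auto simp: flat_exp_def eventually_at_filter exp_minus field_simps power_inverse)
  moreover have "(flat_exp m \<longlongrightarrow> 0) (at_left 0)"
    by (rule tendsto_eventually) (auto simp: flat_exp_def eventually_at_filter)
  ultimately show ?thesis by (simp add: filterlim_split_at_real)
qed

lemma has_real_derivative_flat_exp:
  "(flat_exp m has_real_derivative flat_exp (m + 2) t - m * flat_exp (m + 1) t) (at t)"
proof -
  consider "t < 0" | "t > 0" | "t = 0" by linarith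
  then show ?thesis
  proof cases
    case 1
    have "((\<lambda>_. 0) has_real_derivative 0) (at t)" by simp
    then have "(flat_exp m has_real_derivative 0) (at t)"
      by (rule has_field_derivative_transform_within_open[of _ _ _ "{..<0}"])
         (use 1 in \<open>auto simp: flat_exp_def\<close>)
    then show ?thesis using 1 by (simp add: flat_exp_def)
  next
    case 2
    have "real m * t ^ (m - Suc 0) = real m * t ^ m / t"
      using 2 by (cases m) auto
    then have "((\<lambda>t. exp (- 1 / t) / t ^ m) has_real_derivative
        flat_exp (m + 2) t - m * flat_exp (m + 1) t) (at t)"
      using 2 by (auto intro!: derivative_eq_intros simp: flat_exp_def field_simps power2_eq_square)
    then show ?thesis
      by (rule has_field_derivative_transform_within_open[of _ _ _ "{0<..}"])
         (use 2 in \<open>auto simp: flat_exp_def\<close>)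
  next
    case 3
    \<comment> \<open>The difference quotient of \<open>flat_exp m\<close> at 0 is
      \<open>flat_exp (m + 1)\<close>.\<close>
    have "((\<lambda>h. (flat_exp m (0 + h) - flat_exp m 0) / h) \<longlongrightarrow> 0) (at 0)"
      using flat_exp_tendsto_0[of "m + 1"]
      by (rule filterlim_cong[THEN iffD1, rotated -1])
         (auto simp: flat_exp_def eventually_at_filter mult_ac)
    then show ?thesis using 3 by (simp add: DERIV_def flat_exp_def)
  qed
qed

text \<open>Unlike the set of bump functions, this algebra is closed under directional derivatives.\<close>

inductive_set bump_algebra :: "'a::euclidean_space \<Rightarrow> real \<Rightarrow> ('a \<Rightarrow> real) set" for c r where
  const: "(\<lambda>_. y) \<in> bump_algebra c r"
| inner: "(\<lambda>x. x \<bullet> v) \<in> bump_algebra c r"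
| flat: "(\<lambda>x. flat_exp m (r\<^sup>2 - (x - c) \<bullet> (x - c))) \<in> bump_algebra c r"
| add: "f \<in> bump_algebra c r \<Longrightarrow> g \<in> bump_algebra c r \<Longrightarrow> (\<lambda>x. f x + g x) \<in> bump_algebra c r"
| mult: "f \<in> bump_algebra c r \<Longrightarrow> g \<in> bump_algebra c r \<Longrightarrow> (\<lambda>x. f x * g x) \<in> bump_algebra c r"

lemma bump_algebra_derivative:
  assumes "f \<in> bump_algebra c r"
  shows "\<exists>f'. (\<forall>x. (f has_derivative f' x) (at x)) \<and> (\<forall>v. (\<lambda>x. f' x v) \<in> bump_algebra c r)"
  using assms
proof induction
  case (const y)
  show ?case
    by (rule exI[of _ "\<lambda>_ _. 0"]) (auto intro: bump_algebra.const)
next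
  case (inner v)
  show ?case
    by (rule exI[of _ "\<lambda>_ h. h \<bullet> v"]) (auto intro!: derivative_eq_intros bump_algebra.const)
next
  case (flat m)
  let ?q = "\<lambda>x. r\<^sup>2 - (x - c) \<bullet> (x - c)"
  \<comment> \<open>Only sums and negative constants are used, no differences, so that the
    derivative matches the generating rules literally.\<close>
  let ?f' = "\<lambda>x h. (flat_exp (m + 2) (?q x) + (- real m) * flat_exp (m + 1) (?q x)) *
      ((- 2) * (x \<bullet> h + - (c \<bullet> h)))"
  have "((\<lambda>x. flat_exp m (?q x)) has_derivative ?f' x) (at x)" for x
  proof -
    have "(?q has_derivative (\<lambda>h. (- 2) * (x \<bullet> h + - (c \<bullet> h)))) (at x)"
      by (auto intro!: derivative_eq_intros simp: fun_eq_iff inner_diff inner_commute algebra_simps)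
    from DERIV_compose_FDERIV[OF has_real_derivative_flat_exp this, of m]
    show ?thesis by (simp add: mult_ac)
  qed
  moreover have "(\<lambda>x. ?f' x v) \<in> bump_algebra c r" for v
    by (intro bump_algebra.intros)
  ultimately show ?case by (intro exI[of _ ?f'] conjI allI)
next
  case (add f g)
  then obtain f' g' where *: "\<And>x. (f has_derivative f' x) (at x)" "\<And>v. (\<lambda>x. f' x v) \<in> bump_algebra c r"
    "\<And>x. (g has_derivative g' x) (at x)" "\<And>v. (\<lambda>x. g' x v) \<in> bump_algebra c r"
    by blast
  show ?case
    by (rule exI[of _ "\<lambda>x h. f' x h + g' x h"])
       (auto intro!: has_derivative_add bump_algebra.add *)
next
  case (mult f g)
  then obtain f' g' where *: "\<And>x. (f has_derivative f' x) (at x)" "\<And>v. (\<lambda>x. f' x v) \<in> bump_algebra c r"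
    "\<And>x. (g has_derivative g' x) (at x)" "\<And>v. (\<lambda>x. g' x v) \<in> bump_algebra c r"
    by blast
  show ?case
    by (rule exI[of _ "\<lambda>x h. f x * g' x h + f' x h * g x"])
       (auto intro!: has_derivative_mult bump_algebra.add bump_algebra.mult * mult.hyps)
qed

text \<open>Every iterated derivative keeps the shape of an algebra element times \<open>w\<close>,
  hence is differentiable again. The constant \<open>w\<close> will be the value of a constant form
  on fixed vectors.\<close>

lemma smooth_on_bump_algebra:
  assumes "f \<in> bump_algebra c r"
  shows "smooth_on UNIV (\<lambda>x. complex_of_real (f x) * w)"
proof -
  have "\<exists>g\<in>bump_algebra c r. iter_deriv vs (\<lambda>x. complex_of_real (f x) * w) =
      (\<lambda>x. complex_of_real (g x) * w)" for vs
  proof (induction vs)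
    case Nil
    then show ?case using assms by auto
  next
    case (Cons v vs)
    then obtain g where g: "g \<in> bump_algebra c r"
      "iter_deriv vs (\<lambda>x. complex_of_real (f x) * w) = (\<lambda>x. complex_of_real (g x) * w)" by blast
    obtain g' where g': "\<And>x. (g has_derivative g' x) (at x)" "\<And>v. (\<lambda>x. g' x v) \<in> bump_algebra c r"
      using bump_algebra_derivative[OF g(1)] by blast
    have "((\<lambda>x. complex_of_real (g x) * w) has_derivative (\<lambda>h. complex_of_real (g' x h) * w)) (at x)" for x
      by (auto intro!: derivative_eq_intros g')
    then have "frechet_derivative (\<lambda>x. complex_of_real (g x) * w) (at x) =
        (\<lambda>h. complex_of_real (g' x h) * w)" for x
      by (rule frechet_derivative_at[symmetric])
    then show ?case using g'(2)[of v] by (auto simp: g(2))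
  qed
  moreover have "(\<lambda>x. complex_of_real (g x) * w) differentiable (at x)"
    if g: "g \<in> bump_algebra c r" for g x
  proof -
    obtain g' where "\<And>x. (g has_derivative g' x) (at x)"
      using bump_algebra_derivative[OF g] by blast
    then have "((\<lambda>x. complex_of_real (g x) * w) has_derivative (\<lambda>h. complex_of_real (g' x h) * w)) (at x)"
      by (auto intro!: derivative_eq_intros)
    then show ?thesis unfolding differentiable_def by blast
  qed
  ultimately show ?thesis unfolding smooth_on_def by metis
qed

definition bump :: "'a::euclidean_space \<Rightarrow> real \<Rightarrow> 'a \<Rightarrow> real" where
  "bump c r x = flat_exp 0 (r\<^sup>2 - (x - c) \<bullet> (x - c))"

lemma bump_in_bump_algebra: "bump c r \<in> bump_algebra c r"
  unfolding bump_def[abs_def] by (rule bump_algebra.flat)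

lemma bump_nonneg: "0 \<le> bump c r x"
  by (simp add: bump_def flat_exp_def)

lemma bump_pos_iff:
  assumes "0 < r"
  shows "0 < bump c r x \<longleftrightarrow> x \<in> ball c r"
proof -
  have "dist c x < r \<longleftrightarrow> (dist c x)\<^sup>2 < r\<^sup>2"
    using assms abs_le_square_iff[of r "dist c x"] zero_le_dist[of c x] by linarith
  then show ?thesis
    by (simp add: bump_def flat_exp_def dist_norm norm_minus_commute dot_square_norm)
qed

lemma bump_le_1: "bump c r x \<le> 1"
  by (simp add: bump_def flat_exp_def)

lemma continuous_on_bump: "continuous_on A (bump c r)"
proof -
  obtain f' where "\<And>x. (bump c r has_derivative f' x) (at x)"
    using bump_algebra_derivative[OF bump_in_bump_algebra] by blast
  then show ?thesis
    by (meson has_derivative_continuous continuous_at_imp_continuous_on)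
qed

section \<open>The current\<close>

lemma set_integrable_compact_support:
  fixes g :: "'a::euclidean_space \<Rightarrow> 'b::{banach,second_countable_topology}"
  assumes "A \<in> sets borel" "continuous_on UNIV g" "compact K" "\<And>x. x \<notin> K \<Longrightarrow> g x = 0"
  shows "set_integrable lborel A g"
proof -
  have "integrable lborel (\<lambda>x. indicator K x *\<^sub>R g x)"
    using assms by (intro borel_integrable_compact) (auto intro: continuous_on_subset)
  also have "(\<lambda>x. indicator K x *\<^sub>R g x) = g"
    using assms(4) by (auto simp: indicator_def)
  finally show ?thesis
    unfolding set_integrable_def using assms(1) by (intro integrable_mult_indicator) auto
qed

text \<open>The difference quotients have integral zero by translation invariance, and they converge dominatedly.\<close>

lemma set_integral_directional_derivative_eq_0:
  fixes g :: "'a::euclidean_space \<Rightarrow> complex"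
  assumes A: "A \<in> sets borel" and inv: "\<And>x t. x + t *\<^sub>R v \<in> A \<longleftrightarrow> x \<in> A"
    and g': "\<And>x. (g has_derivative g' x) (at x)"
    and cont: "continuous_on UNIV (\<lambda>x. g' x v)"
    and K: "compact K" and off: "\<And>x. x \<notin> K \<Longrightarrow> g x = 0"
  shows "(LINT x:A|lborel. g' x v) = 0"
proof -
  have [measurable]: "A \<in> sets borel" by (rule A)
  have contg: "continuous_on UNIV g"
    using g' by (meson has_derivative_continuous continuous_at_imp_continuous_on)
  have [measurable]: "g \<in> borel_measurable borel" "(\<lambda>x. g' x v) \<in> borel_measurable borel"
    using contg cont by (auto intro: borel_measurable_continuous_onI)
  have off': "g' x v = 0" if "x \<notin> K" for x
  proof -
    have "((\<lambda>_. 0) has_derivative (\<lambda>_. 0)) (at x)" by simp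
    then have "(g has_derivative (\<lambda>_. 0)) (at x)"
      by (rule has_derivative_transform_within_open[of _ _ _ _ "- K"])
         (use that off compact_imp_closed[OF K] in auto)
    then show ?thesis using has_derivative_unique[OF g'] by metis
  qed
  obtain B where "B \<ge> 0" and B: "\<And>x. norm (g' x v) \<le> B"
  proof -
    have "bounded ((\<lambda>x. g' x v) ` K)"
      using cont K by (intro compact_imp_bounded compact_continuous_image) (auto intro: continuous_on_subset)
    then obtain B where "\<And>x. x \<in> K \<Longrightarrow> norm (g' x v) \<le> B"
      unfolding bounded_iff by auto
    then have "norm (g' x v) \<le> max B 0" for x
      by (cases "x \<in> K") (auto simp: off' intro: max.coboundedI1)
    then show ?thesis by (intro that[of "max B 0"]) auto
  qed
  \<comment> \<open>\<open>L\<close> is a common compact support of all the difference quotients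
    \<open>q n\<close>, since their steps \<open>\<delta> n\<close> lie in
    \<open>{0..1}\<close>.\<close>
  define L where "L = (\<lambda>(x, t). x - t *\<^sub>R v) ` (K \<times> {0..1})"
  have L: "compact L" unfolding L_def
    using K by (intro compact_continuous_image compact_Times) (auto intro!: continuous_intros simp: case_prod_unfold)
  define \<delta> where "\<delta> n = inverse (real (Suc n))" for n
  have \<delta>: "0 < \<delta> n" "\<delta> n \<le> 1" for n by (auto simp: \<delta>_def field_simps)
  define q where "q n x = (g (x + \<delta> n *\<^sub>R v) - g x) /\<^sub>R \<delta> n" for n x
  have line: "((\<lambda>t. g (x + t *\<^sub>R v)) has_derivative (\<lambda>h. g' (x + t *\<^sub>R v) (h *\<^sub>R v))) (at t)" for x t
    by (rule has_derivative_compose[where f = "\<lambda>t. x + t *\<^sub>R v" and g = g, OF _ g'])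
       (auto intro!: derivative_eq_intros)
  have scale: "g' x (h *\<^sub>R v) = h *\<^sub>R g' x v" for x h
    using g'[of x] by (metis bounded_linear.linear has_derivative_bounded_linear linear_scale)
  \<comment> \<open>The mean value inequality along the segment bounds all quotients by the bound on
    the derivative.\<close>
  have qB: "norm (q n x) \<le> B" for n x
  proof -
    have "continuous_on {0..\<delta> n} (\<lambda>t. g (x + t *\<^sub>R v))"
      by (rule continuous_on_compose2[OF contg]) (auto intro!: continuous_intros)
    then obtain t where "norm (g (x + \<delta> n *\<^sub>R v) - g (x + 0 *\<^sub>R v)) \<le> norm (g' (x + t *\<^sub>R v) ((\<delta> n - 0) *\<^sub>R v))"
      using mvt_general[of 0 "\<delta> n" "\<lambda>t. g (x + t *\<^sub>R v)" "\<lambda>t h. g' (x + t *\<^sub>R v) (h *\<^sub>R v)"]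
        \<delta>[of n] line
      by auto
    also have "\<dots> \<le> \<delta> n * B" using \<delta>[of n] B by (simp add: scale)
    finally have "norm (g (x + \<delta> n *\<^sub>R v) - g x) / \<delta> n \<le> B"
      using \<delta>[of n] by (simp add: pos_divide_le_eq mult.commute)
    also have "norm (g (x + \<delta> n *\<^sub>R v) - g x) / \<delta> n = norm (q n x)"
      using \<delta>[of n] by (simp add: q_def divide_inverse mult.commute)
    finally show ?thesis .
  qed
  have qL: "q n x = 0" if "x \<notin> L" for n x
  proof -
    have "x \<notin> K" using that by (force simp: L_def image_def)
    moreover have "x + \<delta> n *\<^sub>R v \<notin> K"
    proof
      assume "x + \<delta> n *\<^sub>R v \<in> K"
      then have "(x + \<delta> n *\<^sub>R v) - \<delta> n *\<^sub>R v \<in> L"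
        unfolding L_def using \<delta>[of n] by (intro image_eqI[of _ _ "(x + \<delta> n *\<^sub>R v, \<delta> n)"]) auto
      then show False using that by simp
    qed
    ultimately show ?thesis by (simp add: q_def off)
  qed
  have lim: "(\<lambda>n. q n x) \<longlonglongrightarrow> g' x v" for x
  proof -
    have "\<delta> \<longlonglongrightarrow> 0" unfolding \<delta>_def[abs_def] by (rule LIMSEQ_inverse_real_of_nat)
    then have "filterlim \<delta> (at 0) sequentially"
      using \<delta>(1) by (auto simp: filterlim_at less_imp_neq[OF \<delta>(1), symmetric])
    moreover have "((\<lambda>h. norm (g (x + h *\<^sub>R v) - g x - h *\<^sub>R g' x v) / norm h) \<longlongrightarrow> 0) (at 0)"
      using line[of x 0] by (simp add: has_derivative_at scale)
    ultimately have "(\<lambda>n. norm (g (x + \<delta> n *\<^sub>R v) - g x - \<delta> n *\<^sub>R g' x v) / norm (\<delta> n)) \<longlonglongrightarrow> 0"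
      by (rule filterlim_compose[rotated])
    also have "(\<lambda>n. norm (g (x + \<delta> n *\<^sub>R v) - g x - \<delta> n *\<^sub>R g' x v) / norm (\<delta> n)) = (\<lambda>n. norm (q n x - g' x v))"
    proof
      fix n
      have "q n x - g' x v = (g (x + \<delta> n *\<^sub>R v) - g x - \<delta> n *\<^sub>R g' x v) /\<^sub>R \<delta> n"
        using \<delta>[of n] by (simp add: q_def algebra_simps)
      then show "norm (g (x + \<delta> n *\<^sub>R v) - g x - \<delta> n *\<^sub>R g' x v) / norm (\<delta> n) = norm (q n x - g' x v)"
        using \<delta>[of n] by (simp add: divide_inverse mult.commute)
    qed
    finally show ?thesis using LIM_zero_iff tendsto_norm_zero_iff by blast
  qed
  have int: "(LINT x:A|lborel. q n x) = 0" for n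
  proof -
    let ?c = "\<delta> n *\<^sub>R v"
    have ig: "set_integrable lborel A g"
      by (rule set_integrable_compact_support[OF A contg K off])
    have ind: "indicator A x = (indicator A (?c + x) :: real)" for x
      using inv[of x "\<delta> n"] by (simp add: indicator_def add.commute)
    have ig': "set_integrable lborel A (\<lambda>x. g (?c + x))"
    proof -
      have "integrable (distr lborel borel ((+) ?c)) (\<lambda>x. indicator A x *\<^sub>R g x)"
        using ig unfolding set_integrable_def lborel_distr_plus .
      then have "integrable lborel (\<lambda>x. indicator A (?c + x) *\<^sub>R g (?c + x))"
        by (subst (asm) integrable_distr_eq) auto
      then show ?thesis unfolding set_integrable_def by (subst ind)
    qed
    have "(LINT x:A|lborel. g x) = integral\<^sup>L (distr lborel borel ((+) ?c)) (\<lambda>x. indicator A x *\<^sub>R g x)"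
      unfolding set_lebesgue_integral_def lborel_distr_plus ..
    also have "\<dots> = (LINT x|lborel. indicator A (?c + x) *\<^sub>R g (?c + x))"
      by (rule integral_distr) auto
    also have "\<dots> = (LINT x:A|lborel. g (?c + x))"
      unfolding set_lebesgue_integral_def ind[symmetric] ..
    finally have "(LINT x:A|lborel. g (?c + x) - g x) = 0"
      using ig ig' by simp
    then show ?thesis
      by (simp add: q_def add.commute divide_inverse scaleR_conv_of_real set_integral_mult_right)
  qed
  have "(\<lambda>n. LINT x:A|lborel. q n x) \<longlonglongrightarrow> (LINT x:A|lborel. g' x v)"
    unfolding set_lebesgue_integral_def
  proof (rule integral_dominated_convergence[where w = "\<lambda>x. indicator L x *\<^sub>R B"])
    show "integrable lborel (\<lambda>x. indicator L x *\<^sub>R B)"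
      using L by (intro borel_integrable_compact) auto
    show "AE x in lborel. norm (indicator A x *\<^sub>R q n x) \<le> indicator L x *\<^sub>R B" for n
      using qB[of n] qL[of _ n] \<open>B \<ge> 0\<close> by (intro always_eventually) (auto simp: indicator_def)
    show "AE x in lborel. (\<lambda>n. indicator A x *\<^sub>R q n x) \<longlonglongrightarrow> indicator A x *\<^sub>R g' x v"
      by (intro always_eventually allI tendsto_scaleR tendsto_const lim)
  qed (auto simp: q_def)
  then show ?thesis by (simp add: int LIMSEQ_const_iff)
qed

section \<open>The current of the cross: continuity, closedness and positivity\<close>

definition cross :: "'n \<Rightarrow> 'n \<Rightarrow> (complex^'n) set" where
  "cross a b = {z. cmod (z $ a) \<le> 1 \<or> cmod (z $ b) \<le> 1}"

text \<open>For distinct directions \<open>s j\<close>, wedging a form with the constant forms in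
  the other coordinates retains only its value on \<open>frame s\<close>, up to a positive constant.
  For forms of degree \<open>2 * k\<close> only the first \<open>2 * k\<close> frame vectors matter,
  so \<open>k\<close> does not occur.\<close>

definition cross_current :: "'n \<Rightarrow> 'n \<Rightarrow> (nat \<Rightarrow> 'n) \<Rightarrow> 'n::finite form \<Rightarrow> complex" where
  "cross_current a b s \<phi> = (LINT z:cross a b|lborel. \<phi> z (frame s))"

lemma cross_borel: "cross a b \<in> sets borel"
  unfolding cross_def by (intro borel_closed closed_Collect_disj closed_Collect_le continuous_intros)

lemma form_eq_0_off_support: "x \<notin> form_support \<phi> \<Longrightarrow> \<phi> x v = 0"
  unfolding form_support_def using closure_subset[of "{x. \<exists>v. \<phi> x v \<noteq> 0}"] by blast

lemma smooth_on_imp_continuous_on: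
  assumes "smooth_on UNIV f"
  shows "continuous_on A f"
proof -
  have "f differentiable (at x)" for x
    using assms unfolding smooth_on_def by (metis UNIV_I iter_deriv.simps(1))
  then show ?thesis
    using differentiable_imp_continuous_within continuous_at_imp_continuous_on by blast
qed

lemma smooth_compact_form_integrable:
  assumes "smooth_compact_form \<phi>" "A \<in> sets borel"
  shows "set_integrable lborel A (\<lambda>z. \<phi> z v)"
  using assms unfolding smooth_compact_form_def
  by (intro set_integrable_compact_support[where K = "form_support \<phi>"])
     (auto intro: smooth_on_imp_continuous_on form_eq_0_off_support)

lemma current_cross_current: "current k (cross_current a b s :: 'n::finite form \<Rightarrow> complex)"
  unfolding current_def
proof (intro conjI allI impI)
  fix \<phi> \<psi> :: "'n form"
  assume "test_form_pq k k \<phi> \<and> test_form_pq k k \<psi>"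
  then show "cross_current a b s (\<lambda>x v. \<phi> x v + \<psi> x v) = cross_current a b s \<phi> + cross_current a b s \<psi>"
    unfolding cross_current_def test_form_pq_def
    by (intro set_integral_add smooth_compact_form_integrable) (auto simp: cross_borel)
next
  fix c and \<phi> :: "'n form"
  show "cross_current a b s (\<lambda>x v. c * \<phi> x v) = c * cross_current a b s \<phi>"
    unfolding cross_current_def by simp
next
  fix K :: "(complex^'n) set"
  assume K: "compact K \<and> K \<subseteq> torus"
  show "\<exists>r C. \<forall>\<phi> B. test_form_pq k k \<phi> \<and> form_support \<phi> \<subseteq> K \<and> 0 \<le> B \<and>
            (\<forall>x vs w. length vs \<le> r \<and> set vs \<subseteq> Basis \<and> range w \<subseteq> Basis \<longrightarrow>
               cmod (iter_deriv vs (\<lambda>y. \<phi> y w) x) \<le> B)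
          \<longrightarrow> cmod (cross_current a b s \<phi>) \<le> C * B"
  \<comment> \<open>The current has order 0: the bound involves no derivatives, and the constant is
    the volume of \<open>K\<close>.\<close>
  proof (rule exI[of _ 0], rule exI[of _ "LINT x|lborel. indicator K x"], intro allI impI)
    fix \<phi> :: "'n form" and B
    assume \<phi>: "test_form_pq k k \<phi> \<and> form_support \<phi> \<subseteq> K \<and> 0 \<le> B \<and>
            (\<forall>x vs w. length vs \<le> 0 \<and> set vs \<subseteq> Basis \<and> range w \<subseteq> Basis \<longrightarrow>
               cmod (iter_deriv vs (\<lambda>y. \<phi> y w) x) \<le> B)"
    then have bound: "cmod (\<phi> x (frame s)) \<le> B" for x
      using frame_in_Basis[of s] by (metis empty_subsetI image_subsetI iter_deriv.simps(1) le_refl list.set(1) list.size(3))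
    have int: "integrable lborel (\<lambda>x. indicator K x * B)"
      using borel_integrable_compact[of K "\<lambda>_. B"] K by auto
    have "cmod (cross_current a b s \<phi>) \<le> (LINT x|lborel. cmod (indicator (cross a b) x *\<^sub>R \<phi> x (frame s)))"
      unfolding cross_current_def set_lebesgue_integral_def by (rule integral_norm_bound)
    also have "\<dots> \<le> (LINT x|lborel. indicator K x * B)"
    proof (rule integral_mono[OF _ int])
      show "integrable lborel (\<lambda>x. cmod (indicator (cross a b) x *\<^sub>R \<phi> x (frame s)))"
        using smooth_compact_form_integrable[OF _ cross_borel] \<phi>
        unfolding test_form_pq_def set_integrable_def by (intro integrable_norm) auto
      show "cmod (indicator (cross a b) x *\<^sub>R \<phi> x (frame s)) \<le> indicator K x * B" for x
        using bound[of x] form_eq_0_off_support[of x \<phi> "frame s"] \<phi>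
        by (auto simp: indicator_def)
    qed
    also have "\<dots> = (LINT x|lborel. indicator K x) * B" by simp
    finally show "cmod (cross_current a b s \<phi>) \<le> (LINT x|lborel. indicator K x) * B" .
  qed
qed

text \<open>By linearity from the basic wedges. This isolates the component \<open>\<psi> k\<close>
  in the proof of closedness.\<close>

lemma frame_restrict_eq_0:
  assumes "of_bidegree p q \<alpha>" "p + q = 2 * k" "p \<noteq> k"
  shows "\<alpha> (frame s) = 0"
proof -
  obtain c where "\<alpha> (frame s) = (\<Sum>I\<in>{..<p} \<rightarrow>\<^sub>E UNIV. \<Sum>J\<in>{..<q} \<rightarrow>\<^sub>E UNIV. c I J * dz_wedge p q I J (frame s))"
    using assms(1) unfolding of_bidegree_def by blast
  then show ?thesis using assms(2,3) by (simp add: dz_wedge_frame_eq_0)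
qed

text \<open>On the frame, the exterior derivative is an alternating sum of derivatives along frame
  vectors. These vectors do not move the coordinates \<open>a\<close> and \<open>b\<close>, so each
  term integrates to zero over \<open>cross a b\<close>.\<close>

lemma closed_cross_current:
  assumes "\<And>j. s j \<noteq> a" "\<And>j. s j \<noteq> b"
  shows "closed_current k (cross_current a b s :: 'n::finite form \<Rightarrow> complex)"
  unfolding closed_current_def
proof (intro allI impI, elim conjE)
  fix m and \<eta> :: "'n form" and \<psi> :: "nat \<Rightarrow> 'n form"
  assume m: "Suc m = 2 * k" and \<eta>: "test_form m \<eta>"
    and \<psi>: "\<forall>r\<le>2 * k. test_form_pq r (2 * k - r) (\<psi> r)"
    and d\<eta>: "ext_deriv m \<eta> = (\<lambda>x v. \<Sum>r\<le>2 * k. \<psi> r x v)"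
  \<comment> \<open>\<open>w i\<close> is the frame with its \<open>i\<close>-th vector deleted, as
    in \<open>ext_deriv\<close>.\<close>
  define w where "w i j = (if j < i then frame s j else frame s (Suc j))" for i j
  have sm: "smooth_on UNIV (\<lambda>y. \<eta> y v)" for v
    using \<eta> by (auto simp: test_form_def smooth_compact_form_def)
  have supp: "compact (form_support \<eta>)"
    using \<eta> by (auto simp: test_form_def smooth_compact_form_def)
  define D where "D i x = frechet_derivative (\<lambda>y. \<eta> y (w i)) (at x)" for i x
  have D: "((\<lambda>y. \<eta> y (w i)) has_derivative D i x) (at x)" for i x
    using sm[of "w i"] unfolding smooth_on_def D_def frechet_derivative_works[symmetric]
    by (metis UNIV_I iter_deriv.simps(1))
  have cont: "continuous_on UNIV (\<lambda>x. D i x v)" for i v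
  proof -
    have "iter_deriv [v] (\<lambda>y. \<eta> y (w i)) differentiable (at x)" for x
      using sm[of "w i"] unfolding smooth_on_def by blast
    then have "(\<lambda>x. D i x v) differentiable (at x)" for x
      by (simp add: D_def)
    then show ?thesis
      using differentiable_imp_continuous_within continuous_at_imp_continuous_on by blast
  qed
  have D0: "D i x = (\<lambda>_. 0)" if "x \<notin> form_support \<eta>" for i x
  proof -
    have "((\<lambda>_. 0) has_derivative (\<lambda>_. 0)) (at x)" by simp
    then have "((\<lambda>y. \<eta> y (w i)) has_derivative (\<lambda>_. 0)) (at x)"
      by (rule has_derivative_transform_within_open[of _ _ _ _ "- form_support \<eta>"])
         (use that supp in \<open>auto simp: form_eq_0_off_support compact_imp_closed\<close>)
    then show ?thesis using has_derivative_unique[OF D] by metis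
  qed
  have "\<psi> k x (frame s) = (\<Sum>i\<le>m. (- 1) ^ i * D i x (frame s i))" for x
  proof -
    have "\<psi> r x (frame s) = 0" if "r \<le> 2 * k" "r \<noteq> k" for r
      using \<psi> that frame_restrict_eq_0[of r "2 * k - r" "\<psi> r x" k s] by (auto simp: test_form_pq_def)
    then have "(\<Sum>r\<le>2 * k. \<psi> r x (frame s)) = (\<Sum>r\<le>2 * k. if r = k then \<psi> k x (frame s) else 0)"
      by (intro sum.cong) auto
    then show ?thesis
      using fun_cong[OF fun_cong[OF d\<eta>], of x "frame s"] by (simp add: ext_deriv_def D_def w_def[abs_def])
  qed
  then have "cross_current a b s (\<psi> k) = (LINT x:cross a b|lborel. (\<Sum>i\<le>m. (- 1) ^ i * D i x (frame s i)))"
    by (simp add: cross_current_def)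
  also have "\<dots> = (\<Sum>i\<le>m. LINT x:cross a b|lborel. (- 1) ^ i * D i x (frame s i))"
    unfolding set_lebesgue_integral_def scaleR_sum_right
  proof (rule Bochner_Integration.integral_sum, fold set_integrable_def)
    show "set_integrable lborel (cross a b) (\<lambda>x. (- 1) ^ i * D i x (frame s i))" for i
      using D0 cont supp
      by (intro set_integrable_compact_support[where K = "form_support \<eta>"])
         (auto intro!: continuous_intros simp: cross_borel)
  qed
  also have "\<dots> = (\<Sum>i\<le>m. (- 1) ^ i * (LINT x:cross a b|lborel. D i x (frame s i)))"
    by simp
  also have "\<dots> = 0"
  proof (intro sum.neutral ballI)
    fix i
    have "(LINT x:cross a b|lborel. D i x (frame s i)) = 0"
      using assms
      by (intro set_integral_directional_derivative_eq_0[OF cross_borel _ D cont supp])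
         (auto simp: cross_def frame_nth form_eq_0_off_support)
    then show "(- 1) ^ i * (LINT x:cross a b|lborel. D i x (frame s i)) = 0" by simp
  qed
  finally show "cross_current a b s (\<psi> k) = 0" .
qed

text \<open>The frame is the oriented real basis of the coordinate plane spanned by the
  \<open>u j\<close>, so the integrand is nonnegative for a positive form. Injectivity gives this
  plane dimension \<open>k\<close>.\<close>

lemma positive_cross_current:
  assumes "inj_on s {..<k}"
  shows "positive_current k (cross_current a b s :: 'n::finite form \<Rightarrow> complex)"
  unfolding positive_current_def
proof (intro allI impI, elim conjE)
  fix \<phi> :: "'n form"
  assume \<phi>: "test_form_pq k k \<phi>" "positive_form k \<phi>"
  define u :: "nat \<Rightarrow> complex^'n" where "u j = axis (s j) 1" for j
  have "inj_on u {..<k}"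
    using assms by (auto simp: inj_on_def u_def axis_eq_axis)
  then have "card (u ` {..<k}) = k" by (simp add: card_image)
  moreover have "u ` {..<k} \<subseteq> cart_basis"
    by (auto simp: u_def cart_basis_def)
  then have "vec.independent (u ` {..<k})"
    using independent_cart_basis vec.independent_mono by blast
  ultimately have dim: "vec.dim (vec.span (u ` {..<k})) = k"
    using vec.dim_span_eq_card_independent[of "u ` {..<k}"] by simp
  have "\<phi> x (frame s) \<in> \<real>\<^sub>\<ge>\<^sub>0" for x
  proof (cases "x \<in> torus")
    case True
    then have "\<phi> x (\<lambda>j. if even j then u (j div 2) else \<i> *s u (j div 2)) \<in> \<real>\<^sub>\<ge>\<^sub>0"
      using \<phi>(2)[unfolded positive_form_def, rule_format, OF True, of "vec.span (u ` {..<k})" u]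
        dim vec.subspace_span by blast
    then show ?thesis unfolding frame_def[abs_def] u_def .
  next
    case False
    then have "\<phi> x (frame s) = 0"
      using \<phi>(1) by (intro form_eq_0_off_support) (auto simp: test_form_pq_def smooth_compact_form_def)
    then show ?thesis by simp
  qed
  then have *: "\<phi> x (frame s) = complex_of_real (Re (\<phi> x (frame s)))" "Re (\<phi> x (frame s)) \<ge> 0" for x
    by (auto simp: complex_nonneg_Reals_iff complex_eq_iff)
  have "cross_current a b s \<phi> = (LINT x|lborel. complex_of_real (indicator (cross a b) x * Re (\<phi> x (frame s))))"
    unfolding cross_current_def set_lebesgue_integral_def
    by (subst *(1)) (simp add: scaleR_conv_of_real)
  also have "\<dots> = complex_of_real (LINT x|lborel. indicator (cross a b) x * Re (\<phi> x (frame s)))"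
    by (rule integral_complex_of_real)
  also have "\<dots> \<in> \<real>\<^sub>\<ge>\<^sub>0"
    by (simp add: *(2))
  finally show "cross_current a b s \<phi> \<in> \<real>\<^sub>\<ge>\<^sub>0" .
qed

section \<open>The corner\<close>

lemma open_torus: "open (torus :: (complex^'n::finite) set)"
proof -
  have "torus = (\<Inter>i. {z :: complex^'n. z $ i \<noteq> 0})" by (auto simp: torus_def)
  moreover have "open (\<Inter>i. {z :: complex^'n. z $ i \<noteq> 0})"
    by (intro open_INT ballI open_Collect_neq continuous_intros) simp
  ultimately show ?thesis by simp
qed

text \<open>Used with \<open>v\<close> equal to the point or its negative, to rescale all moduli at
  once, and with boundary directions at the corner.\<close>

lemma open_ray:
  fixes x v :: "'a::real_normed_vector"
  assumes "open U" "x \<in> U"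
  shows "\<exists>e>0. \<forall>t. \<bar>t\<bar> < e \<longrightarrow> x + t *\<^sub>R v \<in> U"
proof -
  have "open ((\<lambda>t. x + t *\<^sub>R v) -` U)"
    by (intro open_vimage assms continuous_intros)
  from this[unfolded open_dist, rule_format, of 0] show ?thesis
    using assms(2) by (simp add: dist_real_def)
qed

text \<open>
  The complement has a convex corner along \<open>\<bar>z\<^sub>a\<bar> = r\<close>, \<open>\<bar>z\<^sub>b\<bar> = q\<close>: the boundary contains a half plane
  in the direction of each of the two axes, so a defining function has vanishing derivative there.
\<close>

lemma not_has_smooth_boundary_cross:
  fixes a b :: "'n::finite"
  assumes "a \<noteq> b" "0 < r" "0 < q"
  shows "\<not> has_smooth_boundary {z \<in> torus. cmod (z $ a) \<le> r \<or> cmod (z $ b) \<le> q}"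
    (is "\<not> has_smooth_boundary ?S")
proof
  assume "has_smooth_boundary ?S"
  then have smooth: "smooth_hypersurface (top_of_set torus frontier_of ?S)"
    by (simp add: has_smooth_boundary_def)
  \<comment> \<open>The dilation by \<open>1 + t\<close> strictly increases both moduli, so it moves
    \<open>z\<close> out of the set for arbitrarily small \<open>t\<close>.\<close>
  have front: "z \<in> top_of_set torus frontier_of ?S"
    if z: "z \<in> ?S" "r \<le> cmod (z $ a)" "q \<le> cmod (z $ b)" for z
  proof -
    have "z \<notin> top_of_set torus interior_of ?S"
    proof
      assume "z \<in> top_of_set torus interior_of ?S"
      moreover have "open (top_of_set torus interior_of ?S)"
        using openin_interior_of[of "top_of_set torus" ?S] open_torus openin_open_eq by blast
      ultimately obtain e where e: "e > 0" "\<And>t. \<bar>t\<bar> < e \<Longrightarrow> z + t *\<^sub>R z \<in> top_of_set torus interior_of ?S"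
        using open_ray[of _ z z] by blast
      define t where "t = e / 2"
      have t: "0 < t" "\<bar>t\<bar> < e" using e by (auto simp: t_def)
      have "z + t *\<^sub>R z \<in> ?S"
        using e(2)[OF t(2)] interior_of_subset[of "top_of_set torus" ?S] by blast
      then have *: "cmod ((z + t *\<^sub>R z) $ a) \<le> r \<or> cmod ((z + t *\<^sub>R z) $ b) \<le> q"
        by blast
      have "cmod ((z + t *\<^sub>R z) $ i) = (1 + t) * cmod (z $ i)" for i
      proof -
        have "(z + t *\<^sub>R z) $ i = complex_of_real (1 + t) * z $ i"
          by (simp add: scaleR_conv_of_real[of t "z $ i"] distrib_right)
        moreover have "\<bar>1 + t\<bar> = 1 + t" using t by simp
        ultimately show ?thesis by (simp only: norm_mult norm_of_real)
      qed
      note *[unfolded this]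
      moreover have "c < (1 + t) * m" if "c \<le> m" "0 < c" for c m :: real
      proof -
        have "0 < t * m" using that t by (intro mult_pos_pos) auto
        then show ?thesis using that by (simp add: distrib_right)
      qed
      note this[OF z(2) assms(2)] this[OF z(3) assms(3)]
      ultimately show False by linarith
    qed
    moreover have "z \<in> top_of_set torus closure_of ?S"
      using z closure_of_subset[of ?S "top_of_set torus"] by auto
    ultimately show ?thesis by (simp add: frontier_of_def)
  qed
  \<comment> \<open>A point of the corner; the entries 1 keep it in the torus.\<close>
  define p :: "complex^'n" where
    "p = (\<chi> i. if i = a then complex_of_real r else if i = b then complex_of_real q else 1)"
  have pa: "p $ a = complex_of_real r" and pb: "p $ b = complex_of_real q"
    using assms by (auto simp: p_def)
  have "p \<in> torus" using assms by (auto simp: torus_def p_def)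
  then have "p \<in> top_of_set torus frontier_of ?S"
    using assms by (intro front) (auto simp: pa pb)
  from bspec[OF smooth[unfolded smooth_hypersurface_def] this]
  obtain U and \<rho> :: "complex^'n \<Rightarrow> real" where U: "open U" "p \<in> U" "U \<subseteq> torus" "smooth_on U \<rho>"
      and M: "top_of_set torus frontier_of ?S \<inter> U = {y \<in> U. \<rho> y = 0}"
      and nz: "\<forall>y\<in>U. frechet_derivative \<rho> (at y) \<noteq> (\<lambda>_. 0)"
    by blast
  define D where "D = frechet_derivative \<rho> (at p)"
  have D: "(\<rho> has_derivative D) (at p)"
    using U unfolding smooth_on_def D_def frechet_derivative_works[symmetric]
    by (metis iter_deriv.simps(1))
  then have lin: "linear D" by (rule has_derivative_linear)
  \<comment> \<open>A one-sided segment of zeros of \<open>\<rho>\<close> suffices: a nonzero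
    derivative at its endpoint would make \<open>\<rho>\<close> strictly larger or smaller just to
    the right.\<close>
  have vanish: "D v = 0"
    if v: "\<And>t. 0 \<le> t \<Longrightarrow> p + t *\<^sub>R v \<in> torus \<Longrightarrow> p + t *\<^sub>R v \<in> top_of_set torus frontier_of ?S" for v
  proof -
    obtain e where e: "e > 0" "\<And>t. \<bar>t\<bar> < e \<Longrightarrow> p + t *\<^sub>R v \<in> U"
      using open_ray[OF U(1,2)] by blast
    have zero: "\<rho> (p + t *\<^sub>R v) = 0" if "0 \<le> t" "t < e" for t
      using v[OF that(1)] e(2)[of t] that U(3) M by auto
    have "((\<lambda>t. \<rho> (p + t *\<^sub>R v)) has_derivative (\<lambda>h. D (h *\<^sub>R v))) (at 0)"
      by (rule has_derivative_compose[where f = "\<lambda>t. p + t *\<^sub>R v" and g = \<rho>])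
         (auto intro!: derivative_eq_intros D)
    then have der: "((\<lambda>t. \<rho> (p + t *\<^sub>R v)) has_real_derivative D v) (at 0)"
      by (simp add: has_field_derivative_def linear_scale[OF lin] mult.commute[of _ "D v"])
    show ?thesis
    proof (rule ccontr)
      assume "D v \<noteq> 0"
      then obtain d where d: "d > 0" "\<And>h. 0 < h \<Longrightarrow> h < d \<Longrightarrow> \<rho> (p + (0 + h) *\<^sub>R v) \<noteq> \<rho> (p + 0 *\<^sub>R v)"
        using DERIV_pos_inc_right[OF der] DERIV_neg_dec_right[OF der]
        by (metis less_irrefl linorder_neqE_linordered_idom)
      define h where "h = min d e / 2"
      have "0 < h" "h < d" "h < e" using d e by (auto simp: h_def min_def)
      then show False using d(2)[of h] zero[of h] zero[of 0] e by auto
    qed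
  qed
  \<comment> \<open>Adding a number with nonnegative real part to \<open>c\<close> keeps the modulus
    at least \<open>c\<close>. With the other special coordinate fixed, the point stays on the
    boundary.\<close>
  have half: "c \<le> cmod (complex_of_real c + t *\<^sub>R w)" if "0 \<le> t" "0 \<le> Re w" for c t w
  proof -
    have "c \<le> Re (complex_of_real c + t *\<^sub>R w)" using that by simp
    then show ?thesis using complex_Re_le_cmod order_trans by blast
  qed
  have Da: "D v = 0" if "v $ a = 0" "0 \<le> Re (v $ b)" for v
    using that half[of _ "v $ b" q] assms by (intro vanish front) (auto simp: pa pb)
  have Db: "D v = 0" if "v $ b = 0" "0 \<le> Re (v $ a)" for v
    using that half[of _ "v $ a" r] assms by (intro vanish front) (auto simp: pa pb)
  \<comment> \<open>A nonnegative multiple of \<open>axis i 1\<close> pushes any vector into the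
    half plane, and \<open>D\<close> vanishes on \<open>axis i 1\<close> itself.\<close>
  have shift: "D v = 0" if "D (v + \<bar>Re (v $ i)\<bar> *\<^sub>R axis i 1) = 0" "D (axis i 1) = 0" for v i
    using that by (simp add: linear_add[OF lin] linear_scale[OF lin])
  have "D v = 0" for v
  proof -
    \<comment> \<open>\<open>v\<close> splits into a part with zero \<open>a\<close> coordinate and
      a part with zero \<open>b\<close> coordinate.\<close>
    have "D (v - axis a (v $ a)) = 0"
      by (rule shift[of _ b]; intro Da) (auto simp: axis_def assms(1) assms(1)[symmetric])
    moreover have "D (axis a (v $ a)) = 0"
      by (rule shift[of _ a]; intro Db) (auto simp: axis_def assms(1) assms(1)[symmetric])
    ultimately show "D v = 0" using linear_diff[OF lin, of v "axis a (v $ a)"] by simp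
  qed
  then show False using bspec[OF nz U(2)] by (auto simp: D_def)
qed

section \<open>The support of the convolution\<close>

text \<open>The supremum runs over the set where \<open>\<mu>\<close> is nonzero, not its closure,
  so values close to it occur where \<open>\<mu>\<close> does not vanish.\<close>

definition radius :: "(complex^'n \<Rightarrow> real) \<Rightarrow> 'n \<Rightarrow> real" where
  "radius \<mu> i = (SUP g\<in>{g. \<mu> g \<noteq> 0}. cmod (g $ i))"

text \<open>A single member of a mollifier family; the corner appears for each member
  separately.\<close>

locale mollifier =
  fixes \<mu> :: "complex^'n::finite \<Rightarrow> real"
  assumes nonneg: "0 \<le> \<mu> g"
    and smooth: "smooth_on UNIV \<mu>"
    and compact_support: "compact (closure {g. \<mu> g \<noteq> 0})"
    and support_torus: "closure {g. \<mu> g \<noteq> 0} \<subseteq> torus"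
    and integral_1: "(LINT g|haar. \<mu> g) = 1"
begin

lemma continuous: "continuous_on A \<mu>"
  by (rule smooth_on_imp_continuous_on[OF smooth])

lemma in_torus: "\<mu> g \<noteq> 0 \<Longrightarrow> g \<in> torus"
  using support_torus closure_subset[of "{g. \<mu> g \<noteq> 0}"] by blast

lemma nonempty: "{g. \<mu> g \<noteq> 0} \<noteq> {}"
proof
  assume "{g. \<mu> g \<noteq> 0} = {}"
  then have "\<mu> = (\<lambda>_. 0)" by auto
  then show False using integral_1 by simp
qed

lemma bdd_above_norm: "bdd_above ((\<lambda>g. cmod (g $ i)) ` {g. \<mu> g \<noteq> 0})"
proof -
  have "compact ((\<lambda>g. cmod (g $ i)) ` closure {g. \<mu> g \<noteq> 0})"
    by (intro compact_continuous_image compact_support continuous_intros)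
  then have "bdd_above ((\<lambda>g. cmod (g $ i)) ` closure {g. \<mu> g \<noteq> 0})"
    by (intro bounded_imp_bdd_above compact_imp_bounded)
  then show ?thesis by (rule bdd_above_mono) (intro image_mono closure_subset)
qed

lemma le_radius: "\<mu> g \<noteq> 0 \<Longrightarrow> cmod (g $ i) \<le> radius \<mu> i"
  unfolding radius_def by (rule cSUP_upper[OF _ bdd_above_norm]) simp

lemma less_radius_iff: "r < radius \<mu> i \<longleftrightarrow> (\<exists>g. \<mu> g \<noteq> 0 \<and> r < cmod (g $ i))"
  unfolding radius_def by (subst less_cSUP_iff[OF nonempty bdd_above_norm]) auto

lemma radius_pos: "0 < radius \<mu> i"
proof -
  obtain g where "\<mu> g \<noteq> 0" using nonempty by blast
  then show ?thesis using in_torus[of g] by (auto simp: less_radius_iff torus_def)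
qed

text \<open>If \<open>\<mu> g \<noteq> 0\<close>, then multiplication by \<open>g\<close> sends a
  coordinate of modulus at most 1 to one of modulus at most \<open>radius \<mu> i\<close>. Hence
  \<open>g\<close> maps the cross off the support of \<open>\<phi>\<close>.\<close>

lemma convolution_cross_current_eq_0:
  assumes "form_support \<phi> \<subseteq> {z. radius \<mu> a < cmod (z $ a) \<and> radius \<mu> b < cmod (z $ b)}"
  shows "convolution \<mu> (cross_current a b s) \<phi> = 0"
proof -
  have "\<mu> g = 0 \<or> cross_current a b s (pullback_mult g \<phi>) = 0" for g
  proof (rule disjCI)
    assume g: "\<not> cross_current a b s (pullback_mult g \<phi>) = 0"
    show "\<mu> g = 0"
    proof (rule ccontr)
      assume "\<mu> g \<noteq> 0"
      have "g * z \<notin> form_support \<phi>" if "z \<in> cross a b" for z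
      proof
        assume "g * z \<in> form_support \<phi>"
        then have "radius \<mu> a < cmod (g $ a) * cmod (z $ a)" "radius \<mu> b < cmod (g $ b) * cmod (z $ b)"
          using assms by (auto simp: norm_mult)
        moreover have "cmod (g $ i) * cmod (z $ i) \<le> radius \<mu> i" if "cmod (z $ i) \<le> 1" for i
          using mult_mono[OF le_radius[OF \<open>\<mu> g \<noteq> 0\<close>, of i] that] radius_pos[of i] by simp
        ultimately show False using that by (fastforce simp: cross_def)
      qed
      then have "cross_current a b s (pullback_mult g \<phi>) = (LINT z:cross a b|lborel. 0)"
        unfolding cross_current_def pullback_mult_def
        by (intro set_lebesgue_integral_cong) (auto simp: cross_borel form_eq_0_off_support)
      then show False using g by simp
    qed
  qed
  then have "complex_of_real (\<mu> g) * cross_current a b s (pullback_mult g \<phi>) = 0" for g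
    by (metis mult_eq_0_iff of_real_0)
  then show ?thesis by (simp only: convolution_def Bochner_Integration.integral_zero)
qed

end

section \<open>Null sets, Haar measure and test forms with constant coefficients\<close>

lemma open_not_AE:
  fixes N :: "'a::euclidean_space set"
  assumes "open N" "N \<noteq> {}"
  shows "\<not> (AE x in lborel. x \<notin> N)"
proof
  assume "AE x in lborel. x \<notin> N"
  then have "N \<in> null_sets lborel"
    using assms(1) by (subst (asm) AE_iff_null_sets[symmetric]) auto
  then have "negligible N"
    unfolding negligible_iff_null_sets by (rule null_sets_completionI)
  then show False using open_not_negligible[OF assms] by simp
qed

lemma dz_wedge_of_bidegree:
  fixes s :: "nat \<Rightarrow> 'n::finite"
  shows "of_bidegree k k (\<lambda>v. c * dz_wedge k k s s v)"
proof -
  \<comment> \<open>\<open>of_bidegree\<close> sums over extensional index functions, so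
    \<open>s\<close> is cut off outside \<open>{..<k}\<close>.\<close>
  define t where "t = restrict s {..<k}"
  have t: "t \<in> {..<k} \<rightarrow>\<^sub>E UNIV" by (simp add: t_def)
  have "dz_wedge k k s s = dz_wedge k k t t"
    by (rule dz_wedge_cong) (auto simp: t_def)
  then have "c * dz_wedge k k s s v = (\<Sum>I\<in>{..<k} \<rightarrow>\<^sub>E UNIV. \<Sum>J\<in>{..<k} \<rightarrow>\<^sub>E UNIV.
      (if I = t then if J = t then c else 0 else 0) * dz_wedge k k I J v)" for v
    using t by (simp add: if_distrib[of "\<lambda>x. x * _"] sum.If_cases finite_PiE cong: if_cong)
  then show ?thesis unfolding of_bidegree_def
    by (intro exI[of _ "\<lambda>I J. if I = t then if J = t then c else 0 else 0"]) blast
qed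

lemma sets_haar [measurable_cong]: "sets haar = sets borel"
  by (simp add: haar_def)

text \<open>The Haar density is strictly positive exactly on the torus.\<close>

lemma AE_haar:
  fixes P :: "complex^'n::finite \<Rightarrow> bool"
  shows "(AE g in haar. P g) \<longleftrightarrow> (AE g in lborel. g \<in> torus \<longrightarrow> P g)"
proof -
  have "0 < (\<Prod>i\<in>UNIV. (cmod (g $ i))\<^sup>2)" if "g \<in> torus" for g :: "complex^'n"
    using that by (auto intro!: prod_pos simp: torus_def)
  then have "0 < ennreal (indicator torus g / (\<Prod>i\<in>UNIV. (cmod (g $ i))\<^sup>2)) \<longleftrightarrow> g \<in> torus" for g :: "complex^'n"
    by (auto simp: indicator_def ennreal_zero_less_divide)
  moreover have "(\<lambda>g :: complex^'n. indicator torus g / (\<Prod>i\<in>UNIV. (cmod (g $ i))\<^sup>2)) \<in> borel_measurable lborel"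
    by (intro borel_measurable_divide borel_measurable_indicator)
       (auto intro!: borel_measurable_continuous_onI continuous_intros borel_open open_torus)
  ultimately show ?thesis unfolding haar_def by (subst AE_density[OF measurable_compose[OF _ measurable_ennreal]]) simp_all
qed

lemma continuous_on_vec_times [continuous_intros]:
  fixes f g :: "'a::topological_space \<Rightarrow> complex^'n"
  assumes "continuous_on A f" "continuous_on A g"
  shows "continuous_on A (\<lambda>x. f x * g x)"
  unfolding times_vec_def using assms by (intro continuous_intros)

section \<open>Nonvanishing of the convolution and its support\<close>

context mollifier
begin

text \<open>The test form is a bump around \<open>x\<close> times a constant form, which makes the
  convolution a double integral of a nonnegative function. It is positive because some
  \<open>g\<close> with \<open>\<mu> g \<noteq> 0\<close> has \<open>i\<close>-th modulus above that
  of \<open>x\<close>, and so carries the point \<open>x / g\<close> of the cross to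
  \<open>x\<close>.\<close>

lemma ex_convolution_cross_current_nonzero:
  assumes inj: "inj_on s {..<k}" and i: "i = a \<or> i = b"
    and U: "open U" "U \<subseteq> torus" "x \<in> U" and x: "cmod (x $ i) < radius \<mu> i"
  shows "\<exists>\<phi>. test_form_pq k k \<phi> \<and> form_support \<phi> \<subseteq> U \<and> convolution \<mu> (cross_current a b s) \<phi> \<noteq> 0"
proof -
  obtain r where r: "r > 0" "cball x r \<subseteq> U" using U open_contains_cball by blast
  define c where "c = inverse (dz_wedge k k s s (frame s))"
  define \<phi> :: "'n form" where "\<phi> y v = complex_of_real (bump x r y) * (c * dz_wedge k k s s v)" for y v
  have "form_support \<phi> \<subseteq> cball x r"
    unfolding form_support_def \<phi>_def using bump_pos_iff[OF r(1), of x] bump_nonneg[of x r]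
    by (intro closure_minimal) (auto simp: less_le)
  then have supp: "compact (form_support \<phi>)" "form_support \<phi> \<subseteq> U"
    using r(2) bounded_subset[OF bounded_cball] by (auto simp: compact_eq_bounded_closed form_support_def)
  have test: "test_form_pq k k \<phi>"
    unfolding test_form_pq_def smooth_compact_form_def
  proof (intro conjI allI supp)
    show "smooth_on UNIV (\<lambda>y. \<phi> y v)" for v
      unfolding \<phi>_def by (rule smooth_on_bump_algebra[OF bump_in_bump_algebra])
    show "form_support \<phi> \<subseteq> torus" using supp U(2) by blast
    show "of_bidegree k k (\<phi> y)" for y
      using dz_wedge_of_bidegree[of k "complex_of_real (bump x r y) * c" s]
      by (simp add: \<phi>_def[abs_def] mult.assoc)
  qed
  \<comment> \<open>The factor that pullback by \<open>g\<close> puts on the wedge: each scale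
    factor meets its conjugate.\<close>
  define \<kappa> where "\<kappa> g = (\<Prod>j<k. (cmod (g $ s j))\<^sup>2)" for g :: "complex^'n"
  define H where "H g z = indicator (cross a b) z * (\<kappa> g * bump x r (g * z))" for g z
  define h where "h g = (LINT z|lborel. H g z)" for g
  have H_nonneg: "0 \<le> H g z" for g z
    by (auto simp: H_def \<kappa>_def bump_nonneg intro!: mult_nonneg_nonneg prod_nonneg)
  have "c * dz_wedge k k s s (frame s) = 1"
    using dz_wedge_frame_nonzero[OF inj] by (simp add: c_def)
  moreover have "(\<Prod>j<k. g $ s j) * (\<Prod>j<k. cnj (g $ s j)) = complex_of_real (\<kappa> g)" for g
    by (simp add: \<kappa>_def flip: prod.distrib complex_norm_square)
  ultimately have "\<phi> (g * z) (\<lambda>j. g * frame s j) = complex_of_real (\<kappa> g * bump x r (g * z))" for g z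
    by (simp add: \<phi>_def dz_wedge_mult mult_ac)
  then have "cross_current a b s (pullback_mult g \<phi>) = (LINT z|lborel. complex_of_real (H g z))" for g
    unfolding cross_current_def pullback_mult_def set_lebesgue_integral_def H_def
    by (simp add: scaleR_conv_of_real)
  then have "cross_current a b s (pullback_mult g \<phi>) = complex_of_real (h g)" for g
    unfolding h_def by (simp only: integral_complex_of_real)
  then have "convolution \<mu> (cross_current a b s) \<phi> = (LINT g|haar. complex_of_real (\<mu> g * h g))"
    by (simp add: convolution_def)
  then have conv: "convolution \<mu> (cross_current a b s) \<phi> = complex_of_real (LINT g|haar. \<mu> g * h g)"
    by (simp only: integral_complex_of_real)

  have [measurable]: "\<mu> \<in> borel_measurable borel"
    by (intro borel_measurable_continuous_onI continuous)
  have cont_\<kappa>: "continuous_on A \<kappa>" for A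
    unfolding \<kappa>_def[abs_def] by (intro continuous_intros)
  have [measurable]: "cross a b \<in> sets borel" by (rule cross_borel)
  \<comment> \<open>Joint measurability in both variables makes the inner integral \<open>h\<close>
    measurable in \<open>g\<close>.\<close>
  have "(\<lambda>p. \<kappa> (fst p) * bump x r (fst p * snd p)) \<in> borel_measurable (borel \<Otimes>\<^sub>M borel)"
    unfolding borel_prod
    by (intro borel_measurable_continuous_onI continuous_on_mult continuous_on_compose2[OF cont_\<kappa>]
        continuous_on_compose2[OF continuous_on_bump] continuous_intros) auto
  moreover have "(\<lambda>p. indicator (cross a b) (snd p)) \<in> borel_measurable (borel \<Otimes>\<^sub>M borel)"
    by (rule measurable_compose[OF measurable_snd borel_measurable_indicator[OF cross_borel]])
  ultimately have H_meas [measurable]: "(\<lambda>(g, z). H g z) \<in> borel_measurable (borel \<Otimes>\<^sub>M borel)"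
    unfolding H_def case_prod_unfold by (rule borel_measurable_times[rotated])
  have h_meas [measurable]: "h \<in> borel_measurable borel"
    unfolding h_def[abs_def] using H_meas
    by (intro lborel.borel_measurable_lebesgue_integral)
       (simp add: measurable_cong_sets[OF sets_pair_measure_cong[OF refl sets_lborel] refl])

  let ?P = "closure {g. \<mu> g \<noteq> 0}"
  have "bdd_above (\<kappa> ` ?P)"
    by (intro bounded_imp_bdd_above compact_imp_bounded compact_continuous_image cont_\<kappa> compact_support)
  then obtain M where M: "\<And>g. g \<in> ?P \<Longrightarrow> \<kappa> g \<le> M"
    unfolding bdd_above_def by blast
  \<comment> \<open>All quotients \<open>y / g\<close> with \<open>g\<close> in the support of \<mu>
    and \<open>y\<close> in the ball; compact because the support avoids zero coordinates. So
    \<open>M\<close> on \<open>W\<close> dominates \<open>H g\<close> uniformly in \<open>g\<close>,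
    which bounds \<open>h\<close> and gives the integrability needed to pass from zero integrals to
    vanishing almost everywhere.\<close>
  define W where "W = (\<lambda>(g, y). \<chi> i. y $ i / g $ i) ` (?P \<times> cball x r)"
  have "compact W"
    unfolding W_def case_prod_unfold using support_torus
    by (intro compact_continuous_image compact_Times compact_support compact_cball continuous_intros)
       (auto simp: torus_def)
  have HW: "H g z \<le> indicator W z *\<^sub>R M" if g: "\<mu> g \<noteq> 0" for g z
  proof (cases "z \<in> W")
    case True
    have "g \<in> ?P" using g closure_subset[of "{g. \<mu> g \<noteq> 0}"] by blast
    moreover have "0 \<le> \<kappa> g" by (auto simp: \<kappa>_def intro: prod_nonneg)
    ultimately have "\<kappa> g * bump x r (g * z) \<le> M * 1"
      using M[of g] bump_le_1[of x r "g * z"] bump_nonneg[of x r "g * z"] by (intro mult_mono) auto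
    moreover have "H g z \<le> \<kappa> g * bump x r (g * z)"
      using \<open>0 \<le> \<kappa> g\<close> bump_nonneg[of x r "g * z"] by (simp add: H_def indicator_def)
    ultimately show ?thesis using True by simp
  next
    case False
    have z: "z = (\<chi> i. (g * z) $ i / g $ i)"
      using in_torus[OF g] by (simp add: Finite_Cartesian_Product.vec_eq_iff torus_def)
    have "g * z \<notin> cball x r"
    proof
      assume "g * z \<in> cball x r"
      then have "(g, g * z) \<in> ?P \<times> cball x r"
        using g closure_subset[of "{g. \<mu> g \<noteq> 0}"] by blast
      moreover have "z = (\<lambda>(g, y). \<chi> i. y $ i / g $ i) (g, g * z)"
        unfolding prod.case by (rule z)
      ultimately have "z \<in> W"
        unfolding W_def by (rule image_eqI[rotated])
      then show False using False by contradiction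
    qed
    then have "bump x r (g * z) = 0"
      using bump_pos_iff[OF r(1), of x "g * z"] bump_nonneg[of x r "g * z"] by (auto simp: less_le)
    then show ?thesis using False by (simp add: H_def)
  qed
  have intW: "integrable lborel (\<lambda>z. indicator W z *\<^sub>R M)"
    by (intro borel_integrable_compact \<open>compact W\<close> continuous_intros)
  have intH: "integrable lborel (H g)" if g: "\<mu> g \<noteq> 0" for g
  proof (rule Bochner_Integration.integrable_bound[OF intW])
    show "H g \<in> borel_measurable lborel"
      using measurable_compose[OF measurable_Pair1' H_meas, of g] by simp
    show "AE z in lborel. norm (H g z) \<le> norm (indicator W z *\<^sub>R M)"
      using HW[OF g] H_nonneg[of g] by (intro always_eventually allI) (simp, meson abs_ge_self order_trans)
  qed
  define C where "C = (LINT z|lborel. indicator W z *\<^sub>R M)"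
  have h_nonneg: "0 \<le> h g" for g
    unfolding h_def by (intro Bochner_Integration.integral_nonneg H_nonneg)
  have h_le: "h g \<le> C" if g: "\<mu> g \<noteq> 0" for g
    unfolding h_def C_def by (intro integral_mono intH intW HW g)
  have int: "integrable haar (\<lambda>g. \<mu> g * h g)"
  proof (rule Bochner_Integration.integrable_bound)
    show "integrable haar (\<lambda>g. C * \<mu> g)"
      \<comment> \<open>A function that is not integrable has integral 0 by convention, so the
        integral 1 forces integrability.\<close>
      using integral_1 not_integrable_integral_eq[of haar \<mu>] by auto
    show "AE g in haar. norm (\<mu> g * h g) \<le> norm (C * \<mu> g)"
    proof (intro always_eventually allI)
      fix g
      show "norm (\<mu> g * h g) \<le> norm (C * \<mu> g)"
        using h_le[of g] h_nonneg[of g] nonneg[of g]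
        by (cases "\<mu> g = 0") (auto simp: abs_mult mult.commute intro!: mult_left_mono)
    qed
  qed measurable

  \<comment> \<open>The \<open>g\<close> that carry a point of the cross to \<open>x\<close> as
    above; there are some because \<open>x\<close> lies strictly inside the radius.\<close>
  define N where "N = {g. \<mu> g \<noteq> 0 \<and> cmod (x $ i) < cmod (g $ i)}"
  have "open N"
    unfolding N_def by (intro open_Collect_conj open_Collect_neq open_Collect_less continuous continuous_intros)
  have "N \<noteq> {}" using x by (auto simp: N_def less_radius_iff)
  have h_pos: "h g \<noteq> 0" if g: "g \<in> N" for g
  proof
    assume "h g = 0"
    have \<mu>g: "\<mu> g \<noteq> 0" using g by (simp add: N_def)
    \<comment> \<open>An open neighbourhood of \<open>x / g\<close> on which \<open>H g\<close> is
      nonzero.\<close>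
    define Z where "Z = {z. cmod (z $ i) < 1 \<and> dist x (g * z) < r}"
    have "open Z"
      unfolding Z_def by (intro open_Collect_conj open_Collect_less continuous_intros)
    moreover have "(\<chi> j. x $ j / g $ j) \<in> Z"
    proof -
      have "g * (\<chi> j. x $ j / g $ j) = x"
        using in_torus[OF \<mu>g] by (simp add: Finite_Cartesian_Product.vec_eq_iff torus_def)
      moreover have "cmod (x $ i / g $ i) < 1"
        using g by (auto simp: N_def norm_divide divide_less_eq_1)
      ultimately show ?thesis using r(1) by (simp add: Z_def)
    qed
    moreover have "H g z \<noteq> 0" if "z \<in> Z" for z
    proof -
      have "z \<in> cross a b" using that i by (auto simp: Z_def cross_def)
      moreover have "bump x r (g * z) \<noteq> 0"
        using that bump_pos_iff[OF r(1), of x "g * z"] by (auto simp: Z_def)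
      moreover have "\<kappa> g \<noteq> 0"
        using in_torus[OF \<mu>g] by (simp add: \<kappa>_def torus_def)
      ultimately show ?thesis by (simp add: H_def)
    qed
    moreover have "AE z in lborel. H g z = 0"
      using integral_nonneg_eq_0_iff_AE[OF intH[OF \<mu>g]] H_nonneg \<open>h g = 0\<close> by (simp add: h_def)
    then have "AE z in lborel. z \<notin> Z"
      by eventually_elim (use calculation(3) in blast)
    ultimately show False using open_not_AE[of Z] by blast
  qed
  have "(LINT g|haar. \<mu> g * h g) \<noteq> 0"
  proof
    assume "(LINT g|haar. \<mu> g * h g) = 0"
    then have "AE g in haar. \<mu> g * h g = 0"
      using integral_nonneg_eq_0_iff_AE[OF int] nonneg h_nonneg by simp
    then have "AE g in lborel. g \<notin> N"
      unfolding AE_haar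
    proof eventually_elim
      case (elim g)
      then show ?case using h_pos[of g] in_torus[of g] by (auto simp: N_def)
    qed
    then show False using open_not_AE[OF \<open>open N\<close> \<open>N \<noteq> {}\<close>] by blast
  qed
  then show ?thesis using test supp conv by (intro exI[of _ \<phi>]) simp
qed

lemma support_convolution_cross_current:
  assumes "inj_on s {..<k}"
  shows "current_support k (convolution \<mu> (cross_current a b s)) =
    {z \<in> torus. cmod (z $ a) \<le> radius \<mu> a \<or> cmod (z $ b) \<le> radius \<mu> b}"
proof (intro equalityI subsetI)
  fix z assume z: "z \<in> current_support k (convolution \<mu> (cross_current a b s))"
  let ?V = "{z. radius \<mu> a < cmod (z $ a) \<and> radius \<mu> b < cmod (z $ b)}"
  have "open (torus \<inter> ?V)"
    by (intro open_Int open_torus open_Collect_conj open_Collect_less continuous_intros)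
  moreover have "convolution \<mu> (cross_current a b s) \<phi> = 0" if "form_support \<phi> \<subseteq> torus \<inter> ?V" for \<phi>
    using that by (intro convolution_cross_current_eq_0) blast
  ultimately have "z \<notin> torus \<inter> ?V"
    using z unfolding current_support_def by blast
  then show "z \<in> {z \<in> torus. cmod (z $ a) \<le> radius \<mu> a \<or> cmod (z $ b) \<le> radius \<mu> b}"
    using z by (auto simp: current_support_def)
next
  fix z assume z: "z \<in> {z \<in> torus. cmod (z $ a) \<le> radius \<mu> a \<or> cmod (z $ b) \<le> radius \<mu> b}"
  then obtain i where i: "i = a \<or> i = b" "cmod (z $ i) \<le> radius \<mu> i" by blast
  have False if U: "open U" "U \<subseteq> torus" "z \<in> U"
    "\<forall>\<phi>. test_form_pq k k \<phi> \<and> form_support \<phi> \<subseteq> U \<longrightarrow> convolution \<mu> (cross_current a b s) \<phi> = 0" for U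
  proof -
    \<comment> \<open>Nonvanishing was shown under a strict inequality, so \<open>z\<close> is
      contracted to \<open>(1 - t) * z\<close> inside \<open>U\<close>; the cap \<open>1 / 2\<close>
      on \<open>t\<close> keeps the factor positive.\<close>
    obtain e where e: "e > 0" "\<And>t. \<bar>t\<bar> < e \<Longrightarrow> z + t *\<^sub>R (- z) \<in> U"
      using open_ray[OF U(1,3)] by blast
    define t where "t = min (e / 2) (1 / 2)"
    have t: "0 < t" "t < 1" "\<bar>t\<bar> < e" using e(1) by (auto simp: t_def)
    have "(z + t *\<^sub>R (- z)) $ i = complex_of_real (1 - t) * z $ i"
      by (simp add: scaleR_conv_of_real[of t "z $ i"] left_diff_distrib)
    moreover have "\<bar>1 - t\<bar> = 1 - t" using t by simp
    ultimately have "cmod ((z + t *\<^sub>R (- z)) $ i) = (1 - t) * cmod (z $ i)"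
      by (simp only: norm_mult norm_of_real)
    also have "\<dots> \<le> (1 - t) * radius \<mu> i" using i t by (intro mult_left_mono) auto
    also have "\<dots> < radius \<mu> i" using t radius_pos[of i] by simp
    finally show False
      using ex_convolution_cross_current_nonzero[OF assms i(1) U(1,2) e(2)[OF t(3)]] U(4) by blast
  qed
  then show "z \<in> current_support k (convolution \<mu> (cross_current a b s))"
    using z unfolding current_support_def by blast
qed

end

section \<open>Choice of coordinates and conclusion\<close>

theorem theorem4:
  fixes k :: nat
  assumes "CARD('n::finite) \<ge> 4"
    and "2 \<le> k" and "k \<le> CARD('n) - 2"
  shows "\<exists>T :: 'n form \<Rightarrow> complex.
    current k T \<and> closed_current k T \<and> positive_current k T \<and>
    \<not> (\<exists>\<mu>. mollifier_family \<mu> \<and>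
          hausdorff_converges (\<lambda>t. current_support k (convolution (\<mu> t) T)) (current_support k T) \<and>
          (\<forall>t\<in>{0<..<1}. has_smooth_boundary (current_support k (convolution (\<mu> t) T))))"
proof -
  have "\<not> CARD('n) \<le> Suc 0" using assms(1) by simp
  then obtain a b :: 'n where "a \<noteq> b"
    using card_le_Suc0_iff_eq[of "UNIV :: 'n set"] by auto
  \<comment> \<open>The remaining coordinates, numerous enough for \<open>k\<close> distinct
    directions.\<close>
  define S where "S = - {a, b}"
  have "card S = CARD('n) - 2"
    using \<open>a \<noteq> b\<close> by (simp add: S_def Compl_eq_Diff_UNIV card_Diff_subset)
  moreover obtain e where e: "bij_betw e {0..<card S} S"
    using ex_bij_betw_nat_finite[of S] by auto
  ultimately have e_S: "e j \<in> S" if "j < k" for j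
    using bij_betwE[OF e] that assms(3) by auto
  have e_inj: "inj_on e {..<k}"
    using bij_betw_imp_inj_on[OF e] by (rule inj_on_subset) (use assms(3) \<open>card S = _\<close> in auto)
  \<comment> \<open>The default \<open>e 0\<close> from \<open>k\<close> on makes \<open>s j\<close>
    avoid \<open>a\<close> and \<open>b\<close> for every \<open>j\<close>; \<open>e j\<close> is
    known to lie in \<open>S\<close> only for \<open>j < k\<close>.\<close>
  define s where "s j = e (if j < k then j else 0)" for j
  have "s j \<in> S" for j using e_S assms(2) by (simp add: s_def)
  then have s: "s j \<noteq> a" "s j \<noteq> b" for j by (auto simp: S_def)
  have inj: "inj_on s {..<k}" using e_inj by (auto simp: inj_on_def s_def)
  have "\<not> (\<forall>t\<in>{0<..<1}. has_smooth_boundary (current_support k (convolution (\<mu> t) (cross_current a b s))))"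
    if "mollifier_family \<mu>" for \<mu>
  proof -
    \<comment> \<open>A corner at one parameter, here \<open>1/2\<close>, contradicts smoothness for
      all of them.\<close>
    interpret mollifier "\<mu> (1/2)"
      using that unfolding mollifier_family_def by unfold_locales auto
    have "\<not> has_smooth_boundary (current_support k (convolution (\<mu> (1/2)) (cross_current a b s)))"
      unfolding support_convolution_cross_current[OF inj]
      by (rule not_has_smooth_boundary_cross[OF \<open>a \<noteq> b\<close> radius_pos radius_pos])
    then show ?thesis by (intro notI) (auto dest: bspec[of _ _ "1/2"])
  qed
  then show ?thesis
    by (intro exI[of _ "cross_current a b s"] conjI current_cross_current closed_cross_current s
        positive_cross_current inj) blast
qed

end
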